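(* Let $q$ be a prime power. Let $P(x,y)$ and $Q(x,y)$ be polynomials in $\mathbb{F}_q[x,y]$ such that $Q(0,0)\neq0$. Let $$F=\mathcal{D}\!\left(\frac{P(x,y)}{Q(x,y)}\right),$$ and write $F(x)=\sum_{n\ge0}a(n)x^n$. Let $h=\max(\deg_x P,\deg_x Q)$ and $d=\max(\deg_y P,\deg_y Q)$, and assume $h\ge1$ and $d\ge1$. Then the size of $\ker_q(a(n)_{n\ge0})$ is at most $$q^{hd}+q^{(h-1)(d-1)}\,\mathcal{L}(h,h,d,d)+2\lfloor\log_q\max(h,d)\rfloor+2.$$ Consequently, $|\ker_q(a(n)_{n\ge0})|$ is in $(1+o(1))\,q^{hd}$ as any one of $q$, $h$, or $d$ tends to infinity and the other two remain constant. That is: if two of the three parameters $q,h,d$ are fixed, there is a function $\varepsilon$ of the remaining parameter, tending to $0$ as that parameter tends to infinity, such that for all such $P,Q$ with these values of $q,h,d$, one has $|\ker_q(a(n)_{n\ge0})|\le(1+\varepsilon)q^{hd}$.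
   Context: The diagonal operator $\mathcal{D}:\mathbb{F}_q[[x,y]]\to\mathbb{F}_q[[x]]$ is $\mathcal{D}\big(\sum_{m,n\ge0}a(m,n)x^my^n\big)=\sum_{n\ge0}a(n,n)x^n$; since $Q(0,0)\neq0$, $P/Q$ is a power series in $\mathbb{F}_q[[x,y]]$. The $q$-kernel of a sequence is $\ker_q(a(n)_{n\ge0})=\{a(q^e n+r)_{n\ge0}: e\ge 0,\ 0\le r\le q^e-1\}$. For a partition $\sigma$ of a positive integer, $\mathrm{lcm}(\sigma)$ is the least common multiple of its parts. $\mathcal{L}(n_1,n_2,n_3,n_4)$ denotes the maximum value of $\mathrm{lcm}(\mathrm{lcm}(\sigma_1),\mathrm{lcm}(\sigma_2),\mathrm{lcm}(\sigma_3),\mathrm{lcm}(\sigma_4))$ where, for each $i$, $\sigma_i$ ranges over integer partitions of integers in $\{1,2,\dots,n_i\}$. *)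

theory Defs
  imports Complex_Main "HOL-Library.Multiset" "HOL-Computational_Algebra.Polynomial_FPS"
begin

context
  includes fps_syntax
begin

text \<open>
  A bivariate polynomial over \<open>'a\<close> is an element of \<open>'a poly poly\<close>, read as
  \<open>'a[x][y]\<close>: the outer variable is \<open>y\<close>, and \<open>coeff (coeff P n) m\<close> is the coefficient of
  \<open>x^m y^n\<close>. Likewise \<open>F $ n $ m\<close> is the coefficient of \<open>x^m y^n\<close> in \<open>F :: 'a fps fps\<close>.
  In particular \<open>P(a,b) = poly (poly P [:b:]) a\<close>, so \<open>P(0,0) = poly (poly P 0) 0\<close>.
\<close>

definition deg_x :: "'a::zero poly poly \<Rightarrow> nat" where
  "deg_x P = Max ((\<lambda>n. degree (coeff P n)) ` {..degree P})"

abbreviation deg_y :: "'a::zero poly poly \<Rightarrow> nat" where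
  "deg_y P \<equiv> degree P"

definition fps2_of_poly2 :: "'a::zero poly poly \<Rightarrow> 'a fps fps" where
  "fps2_of_poly2 P = fps_of_poly (map_poly fps_of_poly P)"

lemma fps2_of_poly2_nth [simp]: "fps2_of_poly2 P $ n $ m = coeff (coeff P n) m"
  by (simp add: fps2_of_poly2_def coeff_map_poly)

text \<open>
  The library division on \<open>'a fps fps\<close> uses \<open>inverse\<close> of the constant term in \<open>'a fps\<close>, which
  is a genuine inverse as soon as the constant coefficient is nonzero. Hence \<open>fps2_quotient P Q\<close>
  is the expansion of \<open>P/Q\<close> whenever \<open>Q(0,0)\<close> is nonzero, which is the only case used.
\<close>

definition fps2_quotient :: "'a::field poly poly \<Rightarrow> 'a poly poly \<Rightarrow> 'a fps fps" where
  "fps2_quotient P Q = fps2_of_poly2 P / fps2_of_poly2 Q"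

lemma fps2_quotient_unique:
  fixes P Q :: "'a::field poly poly"
  assumes "poly (poly Q 0) 0 \<noteq> 0"
  shows "F * fps2_of_poly2 Q = fps2_of_poly2 P \<longleftrightarrow> F = fps2_quotient P Q"
proof -
  let ?Q = "fps2_of_poly2 Q"
  have nz: "?Q $ 0 $ 0 \<noteq> 0"
    using assms by (simp add: poly_0_coeff_0)
  then have nz0: "?Q $ 0 \<noteq> 0"
    by (metis fps_zero_nth)
  have "?Q $ 0 * inverse (?Q $ 0) = 1"
    using inverse_mult_eq_1[OF nz] by (simp add: mult.commute)
  then have inv: "?Q * inverse ?Q = 1"
    by (simp add: fps_inverse_def fps_right_inverse)
  have quot: "fps2_quotient P Q = fps2_of_poly2 P * inverse ?Q"
    using nz0 by (simp add: fps2_quotient_def fps_divide_unit)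
  show ?thesis
  proof
    assume "F * ?Q = fps2_of_poly2 P"
    then have "fps2_of_poly2 P * inverse ?Q = F * (?Q * inverse ?Q)"
      by (simp add: mult.assoc)
    with inv quot show "F = fps2_quotient P Q" by simp
  next
    assume "F = fps2_quotient P Q"
    then have "F * ?Q = fps2_of_poly2 P * (?Q * inverse ?Q)"
      by (simp add: quot mult_ac)
    with inv show "F * ?Q = fps2_of_poly2 P" by simp
  qed
qed

definition diagonal :: "'a fps fps \<Rightarrow> 'a fps" where
  "diagonal F = Abs_fps (\<lambda>n. F $ n $ n)"

definition q_kernel :: "nat \<Rightarrow> (nat \<Rightarrow> 'a) \<Rightarrow> (nat \<Rightarrow> 'a) set" where
  "q_kernel q a = {\<lambda>n. a (q ^ e * n + r) | e r. r \<le> q ^ e - 1}"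

end

text \<open>Integer partitions are multisets of positive natural numbers.\<close>

definition is_partition_of :: "nat multiset \<Rightarrow> nat \<Rightarrow> bool" where
  "is_partition_of \<sigma> n \<longleftrightarrow> 0 \<notin># \<sigma> \<and> sum_mset \<sigma> = n"

definition partitions_upto :: "nat \<Rightarrow> nat multiset set" where
  "partitions_upto n = {\<sigma>. \<exists>k\<in>{1..n}. is_partition_of \<sigma> k}"

definition lcm_partition :: "nat multiset \<Rightarrow> nat" where
  "lcm_partition \<sigma> = Lcm (set_mset \<sigma>)"

definition landau_lcms :: "nat \<Rightarrow> nat \<Rightarrow> nat \<Rightarrow> nat \<Rightarrow> nat set" where
  "landau_lcms n1 n2 n3 n4 =
     {lcm (lcm (lcm_partition \<sigma>1) (lcm_partition \<sigma>2)) (lcm (lcm_partition \<sigma>3) (lcm_partition \<sigma>4)) |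
        \<sigma>1 \<sigma>2 \<sigma>3 \<sigma>4. \<sigma>1 \<in> partitions_upto n1 \<and> \<sigma>2 \<in> partitions_upto n2 \<and>
                    \<sigma>3 \<in> partitions_upto n3 \<and> \<sigma>4 \<in> partitions_upto n4}"

definition landau4 :: "nat \<Rightarrow> nat \<Rightarrow> nat \<Rightarrow> nat \<Rightarrow> nat" where
  "landau4 n1 n2 n3 n4 = Max (landau_lcms n1 n2 n3 n4)"

text \<open>The set whose maximum is taken is finite and nonempty, so \<open>Max\<close> is the actual maximum.\<close>

lemma lcm_partition_dvd_fact:
  assumes "\<sigma> \<in> partitions_upto n"
  shows "lcm_partition \<sigma> dvd fact n"
proof -
  have "k dvd fact n" if k: "k \<in># \<sigma>" for k
  proof -
    from assms have \<sigma>: "sum_mset \<sigma> \<le> n" "0 \<notin># \<sigma>"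
      unfolding partitions_upto_def is_partition_of_def mem_Collect_eq Bex_def atLeastAtMost_iff
      by blast+
    obtain \<tau> where "\<sigma> = add_mset k \<tau>"
      using k by (meson multi_member_split)
    with \<sigma> have "1 \<le> k" "k \<le> n" by simp_all
    then show ?thesis by (rule dvd_fact)
  qed
  then show ?thesis by (auto simp: lcm_partition_def intro: Lcm_least)
qed

lemma finite_landau_lcms: "finite (landau_lcms n1 n2 n3 n4)"
proof (rule finite_subset)
  let ?N = "fact n1 * fact n2 * fact n3 * fact n4 :: nat"
  show "landau_lcms n1 n2 n3 n4 \<subseteq> {k. k dvd ?N}"
  proof
    fix k assume "k \<in> landau_lcms n1 n2 n3 n4"
    then obtain \<sigma>1 \<sigma>2 \<sigma>3 \<sigma>4 where
      k: "k = lcm (lcm (lcm_partition \<sigma>1) (lcm_partition \<sigma>2)) (lcm (lcm_partition \<sigma>3) (lcm_partition \<sigma>4))"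
      and \<sigma>: "\<sigma>1 \<in> partitions_upto n1" "\<sigma>2 \<in> partitions_upto n2"
             "\<sigma>3 \<in> partitions_upto n3" "\<sigma>4 \<in> partitions_upto n4"
      unfolding landau_lcms_def by blast
    note dv = \<sigma>[THEN lcm_partition_dvd_fact]
    have "lcm_partition \<sigma>1 dvd ?N" by (rule dvd_mult2, rule dvd_mult2, rule dvd_mult2, rule dv(1))
    moreover have "lcm_partition \<sigma>2 dvd ?N" by (rule dvd_mult2, rule dvd_mult2, rule dvd_mult, rule dv(2))
    moreover have "lcm_partition \<sigma>3 dvd ?N" by (rule dvd_mult2, rule dvd_mult, rule dv(3))
    moreover have "lcm_partition \<sigma>4 dvd ?N" by (rule dvd_mult, rule dv(4))
    ultimately have "k dvd ?N"
      unfolding k by (intro lcm_least)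
    then show "k \<in> {k. k dvd ?N}" by simp
  qed
  show "finite {k. k dvd ?N}" by (rule finite_divisors_nat) simp
qed

lemma landau_lcms_nonempty:
  assumes "n1 \<ge> 1" "n2 \<ge> 1" "n3 \<ge> 1" "n4 \<ge> 1"
  shows "landau_lcms n1 n2 n3 n4 \<noteq> {}"
proof -
  have "{#1#} \<in> partitions_upto n" if "n \<ge> 1" for n
    using that by (auto simp: partitions_upto_def is_partition_of_def)
  with assms show ?thesis unfolding landau_lcms_def by blast
qed

definition kernel_bound :: "nat \<Rightarrow> nat \<Rightarrow> nat \<Rightarrow> real" where
  "kernel_bound q h d =
     real q ^ (h * d) + real q ^ ((h - 1) * (d - 1)) * real (landau4 h h d d)
     + 2 * real_of_int \<lfloor>log (real q) (real (max h d))\<rfloor> + 2"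

text \<open>
  The error function of the asymptotic statement. It is given explicitly because it has to be
  uniform over all fields of all orders \<open>q\<close>: types cannot be quantified inside a formula, and an
  \<open>\<epsilon>\<close> that is existentially quantified in a statement about one fixed type \<open>'a\<close> could depend on
  \<open>'a\<close>, which would make the limit \<open>q \<rightarrow> \<infinity>\<close> vacuous. The constant below involves no
  type variable.
\<close>

definition kernel_eps :: "nat \<Rightarrow> nat \<Rightarrow> nat \<Rightarrow> real" where
  "kernel_eps q h d = kernel_bound q h d / real q ^ (h * d) - 1"

end

theory Submission
  imports Defs "HOL-Computational_Algebra.Polynomial_Factorial" "HOL-Real_Asymp.Real_Asymp"
begin

text \<open>
  Every sequence in the \<open>q\<close>-kernel is the diagonal of some \<open>S/Q\<close>: by the Frobenius identity
  \<open>Q(x,y)^q = Q(x^q,y^q)\<close>, extracting the residue class \<open>r\<close> replaces \<open>S\<close> by the class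
  \<open>(r,r)\<close> of \<open>S Q^(q-1)\<close>. For \<open>r \<noteq> 0\<close> this operator sends polynomials of degrees at most
  \<open>(h,d)\<close> to degrees at most \<open>(h-1,d-1)\<close>, where all these operators stay; this gives the term
  \<open>q^(hd)\<close>. What remains is the orbit of \<open>P\<close> under the operator for \<open>r = 0\<close>. That
  operator acts on the four edges of the box \<open>[0,h] \<times> [0,d]\<close> separately, as the univariate operator
  \<open>S \<mapsto> \<Lambda>(S R^(q-1))\<close> with \<open>R\<close> the edge of \<open>Q\<close>, and an edge value leaves
  \<open>q^((h-1)(d-1))\<close> choices for the interior. If \<open>R = X^k \<rho>\<close> with \<open>\<rho>(0) \<noteq> 0\<close> and
  \<open>l\<close> is the least common multiple of the degrees of the irreducible factors of \<open>\<rho>\<close>, then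
  \<open>\<rho>\<close> divides \<open>(X^(q^l-1) - 1)^(q^s)\<close> as soon as \<open>q^s \<ge> deg \<rho>\<close>; so the coefficients of
  \<open>S/\<rho>\<close> are eventually periodic and the orbit of an edge has period \<open>l\<close> after \<open>s\<close> steps.

  For the asymptotics it suffices that the Landau function is at most \<open>n powr sqrt (2 n)\<close>.
\<close>

section \<open>Polynomials over a finite field\<close>

text \<open>The disjunct \<open>p = 0\<close> keeps the count right at \<open>n = 0\<close>, because
  \<open>degree 0 = 0\<close>. Each \<open>pCons\<close> contributes one free coefficient.\<close>

lemma card_poly_degree_less:
  "card {p :: 'a::{field,finite} poly. p = 0 \<or> degree p < n} = card (UNIV :: 'a set) ^ n
   \<and> finite {p :: 'a poly. p = 0 \<or> degree p < n}"
proof (induction n)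
  case 0
  have "{p :: 'a poly. p = 0 \<or> degree p < 0} = {0}" by auto
  then show ?case by simp
next
  case (Suc n)
  let ?A = "\<lambda>n. {p :: 'a poly. p = 0 \<or> degree p < n}"
  have eq: "?A (Suc n) = (\<lambda>(a, p). pCons a p) ` (UNIV \<times> ?A n)"
  proof (intro set_eqI iffI)
    fix p assume p: "p \<in> ?A (Suc n)"
    obtain a r where r: "p = pCons a r" by (cases p) auto
    have "r \<in> ?A n" using p r by (auto split: if_splits)
    then show "p \<in> (\<lambda>(a, p). pCons a p) ` (UNIV \<times> ?A n)" using r by auto
  next
    fix p assume "p \<in> (\<lambda>(a, p). pCons a p) ` (UNIV \<times> ?A n)"
    then obtain a r where r: "p = pCons a r" "r \<in> ?A n" by auto
    then show "p \<in> ?A (Suc n)" by (cases "r = 0") auto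
  qed
  have inj: "inj_on (\<lambda>(a, p). pCons a p) (UNIV \<times> ?A n)"
    by (auto simp: inj_on_def)
  show ?case
    unfolding eq using Suc.IH by (simp add: card_image[OF inj] card_cartesian_product)
qed

text \<open>Multiplication by a nonzero \<open>c\<close> permutes the nonzero elements, so their
  product absorbs the factor \<open>c ^ card ?A\<close>, which is therefore
  \<open>1\<close>.\<close>

lemma finite_field_power_card:
  fixes c :: "'a::{field,finite}"
  shows "c ^ card (UNIV :: 'a set) = c"
proof (cases "c = 0")
  case True
  have "card (UNIV :: 'a set) \<noteq> 0" by simp
  with True show ?thesis by (simp add: power_0_left)
next
  case False
  let ?A = "UNIV - {0 :: 'a}"
  have inj: "inj_on ((*) c) ?A" using False by (auto simp: inj_on_def)
  have img: "(*) c ` ?A = ?A"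
    by (rule endo_inj_surj) (use False inj in auto)
  have "\<Prod>?A = (\<Prod>x\<in>?A. c * x)"
    using prod.reindex_bij_betw[of "(*) c" ?A ?A "\<lambda>x. x"] img inj
    unfolding bij_betw_def by metis
  also have "\<dots> = c ^ card ?A * \<Prod>?A" by (simp add: prod.distrib)
  finally have "c ^ card ?A = 1" by simp
  moreover have "card (UNIV :: 'a set) = Suc (card ?A)"
    using card.remove[of "UNIV :: 'a set" 0] by simp
  ultimately show ?thesis by (metis mult.right_neutral power_Suc)
qed

text \<open>\<open>(X + 1)^q - X^q - 1\<close> has degree less than \<open>q\<close> and vanishes on the whole field, so it is zero.\<close>

lemma of_nat_card_choose_eq_0:
  assumes "0 < k" "k < card (UNIV :: 'a::{field,finite} set)"
  shows "(of_nat (card (UNIV :: 'a set) choose k) :: 'a) = 0"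
proof -
  let ?q = "card (UNIV :: 'a set)"
  let ?p = "\<Sum>k\<in>{0<..<?q}. monom (of_nat (?q choose k) :: 'a) k"
  have "poly ?p x = 0" for x
  proof -
    have split: "{..?q} = insert 0 (insert ?q {0<..<?q})" using assms by auto
    have "(x + 1) ^ ?q = (\<Sum>k\<le>?q. of_nat (?q choose k) * x ^ k)"
      by (simp add: binomial_ring)
    also have "\<dots> = 1 + x ^ ?q + poly ?p x"
      unfolding split using assms by (simp add: poly_sum poly_monom algebra_simps)
    finally show ?thesis by (simp add: finite_field_power_card)
  qed
  then have roots: "{x. poly ?p x = 0} = UNIV" by auto
  have "degree ?p \<le> ?q - 1"
    by (rule degree_sum_le) (auto intro: order_trans[OF degree_monom_le])
  then have "?p = 0"
    using card_poly_roots_bound[of ?p] roots assms by (cases "?p = 0") auto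
  moreover have "coeff ?p k = of_nat (?q choose k)"
    using assms by (simp add: coeff_sum coeff_monom)
  ultimately show ?thesis by simp
qed

lemma two_le_card_field: "2 \<le> card (UNIV :: 'a::{field,finite} set)"
proof -
  have "card {0, 1 :: 'a} \<le> card (UNIV :: 'a set)" by (rule card_mono) auto
  then show ?thesis by simp
qed

text \<open>The hypothesis speaks of binomials in the ring and not of a characteristic, so that
  polynomials and power series inherit it from the field through
  \<open>of_nat_card_choose_eq_0\<close>.\<close>

lemma frobenius_add:
  fixes u v :: "'b::comm_ring_1"
  assumes "\<And>k. 0 < k \<Longrightarrow> k < q \<Longrightarrow> of_nat (q choose k) = (0 :: 'b)" and "0 < q"
  shows "(u + v) ^ q = u ^ q + v ^ q"
proof -
  have split: "{..q} = insert 0 (insert q {0<..<q})" using assms(2) by auto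
  have "(u + v) ^ q = (\<Sum>k\<le>q. of_nat (q choose k) * u ^ k * v ^ (q - k))"
    by (rule binomial_ring)
  also have "\<dots> = v ^ q + (u ^ q + (\<Sum>k\<in>{0<..<q}. of_nat (q choose k) * u ^ k * v ^ (q - k)))"
    unfolding split using assms(2) by simp
  also have "(\<Sum>k\<in>{0<..<q}. of_nat (q choose k) * u ^ k * v ^ (q - k)) = 0"
    using assms(1) by (intro sum.neutral) auto
  finally show ?thesis by simp
qed

lemma frobenius_sum:
  fixes f :: "'i \<Rightarrow> 'b::comm_ring_1"
  assumes "\<And>k. 0 < k \<Longrightarrow> k < q \<Longrightarrow> of_nat (q choose k) = (0 :: 'b)" and "0 < q"
  shows "(\<Sum>i\<in>I. f i) ^ q = (\<Sum>i\<in>I. f i ^ q)"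
  using assms(2) frobenius_add[OF assms] by (induction I rule: infinite_finite_induct) (auto simp: power_0_left)

lemma frobenius_power_diff_1:
  fixes u :: "'b::comm_ring_1"
  assumes "\<And>k. 0 < k \<Longrightarrow> k < q \<Longrightarrow> of_nat (q choose k) = (0 :: 'b)" and "0 < q"
  shows "(u - 1) ^ (q ^ s) = u ^ (q ^ s) - 1"
proof (induction s)
  case (Suc s)
  have "(u ^ (q ^ s) - 1) ^ q + 1 ^ q = (u ^ (q ^ s)) ^ q"
    \<comment> \<open>Adding \<open>1\<close> back avoids having to evaluate
      \<open>(- 1) ^ q\<close>.\<close>
    using frobenius_add[OF assms, of "u ^ (q ^ s) - 1" 1] by simp
  then have "(u ^ (q ^ s) - 1) ^ q = (u ^ q ^ s) ^ q - 1"
    by (simp add: eq_diff_eq)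
  then have "((u - 1) ^ q ^ s) ^ q = (u ^ q ^ s) ^ q - 1"
    by (simp only: Suc.IH)
  then show ?case by (simp add: mult.commute[of q] flip: power_mult)
qed simp

text \<open>A nonconstant divisor of least degree cannot split into two nonconstant factors.\<close>

lemma irreducible_factor_exists:
  fixes p :: "'a::field poly"
  assumes "0 < degree p"
  obtains r where "irreducible r" "r dvd p" "0 < degree r"
proof -
  define r where "r = arg_min degree (\<lambda>r. r dvd p \<and> 0 < degree r)"
  have r: "r dvd p \<and> 0 < degree r" and
    least: "\<And>s. s dvd p \<Longrightarrow> 0 < degree s \<Longrightarrow> degree r \<le> degree s"
    unfolding r_def using assms arg_min_nat_lemma[of "\<lambda>r. r dvd p \<and> 0 < degree r" p degree]
    by auto
  have "irreducible r"
  proof (rule irreducibleI)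
    show "r \<noteq> 0" using r by auto
    then show "\<not> r dvd 1" using r by (simp add: is_unit_iff_degree)
    fix a b assume ab: "r = a * b"
    have nz: "a \<noteq> 0" "b \<noteq> 0" using ab r by auto
    then have deg: "degree r = degree a + degree b" by (simp add: ab degree_mult_eq)
    have "a dvd p" using ab r dvd_mult_left by blast
    then have "degree a = 0 \<or> degree r \<le> degree a" using least by blast
    then show "a dvd 1 \<or> b dvd 1" using deg nz by (auto simp: is_unit_iff_degree)
  qed
  with r that show ?thesis by blast
qed

text \<open>Fermat's argument: multiplication by \<open>X\<close> permutes the nonzero residues modulo \<open>r\<close>.\<close>

lemma irreducible_dvd_monom_diff_1:
  fixes r :: "'a::{field,finite} poly"
  assumes irr: "irreducible r" and deg: "0 < degree r" and c0: "coeff r 0 \<noteq> 0"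
  shows "r dvd monom 1 (card (UNIV :: 'a set) ^ degree r - 1) - 1"
proof -
  let ?A = "{p :: 'a poly. p = 0 \<or> degree p < degree r} - {0}"
  let ?X = "monom 1 1 :: 'a poly"
  let ?f = "\<lambda>p. (?X * p) mod r"
  have prime: "prime_elem r" using irr by (rule field_poly_irreducible_imp_prime)
  have finA: "finite ?A" using card_poly_degree_less by blast
  have small: "\<not> r dvd p" if "p \<in> ?A" for p
    using that by (auto dest!: dvd_imp_degree_le)
  \<comment> \<open>The condition on \<open>coeff r 0\<close> enters here: it excludes that
    \<open>r\<close> is \<open>X\<close> up to a unit, so that \<open>X\<close> is invertible modulo
    \<open>r\<close>.\<close>
  have nX: "\<not> r dvd ?X"
  proof
    assume "r dvd ?X"
    then obtain s where s: "?X = r * s" by (elim dvdE)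
    have "coeff (r * s) 0 = 0" unfolding s[symmetric] by simp
    then have "coeff s 0 = 0" using c0 by (simp add: coeff_mult_0)
    then obtain t where t: "s = ?X * t"
      by (cases s) (auto simp: monom_altdef)
    from s have "?X * (r * t) = ?X * 1" by (simp add: t mult_ac)
    then have "r * t = 1" by (metis mult_left_cancel monom_eq_0_iff zero_neq_one)
    then have "r dvd 1" by (metis dvd_triv_left)
    with deg show False using is_unit_iff_degree[of r] prime by (auto simp: prime_elem_def)
  qed
  have inj: "inj_on ?f ?A"
  proof (rule inj_onI)
    fix a b assume ab: "a \<in> ?A" "b \<in> ?A" "?f a = ?f b"
    then have "r dvd ?X * (a - b)" by (simp add: mod_eq_dvd_iff right_diff_distrib)
    then have "r dvd a - b" using prime nX by (auto simp: prime_elem_dvd_mult_iff)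
    moreover have "a - b = 0 \<or> degree (a - b) < degree r" using ab
      by (auto intro: degree_diff_less)
    ultimately have "a - b = 0" using small[of "a - b"] by blast
    then show "a = b" by simp
  qed
  have maps: "?f ` ?A \<subseteq> ?A"
  proof
    fix b assume "b \<in> ?f ` ?A"
    then obtain a where a: "a \<in> ?A" "b = ?f a" by blast
    have "\<not> r dvd ?X * a"
      using prime nX small[OF a(1)] by (auto simp: prime_elem_dvd_mult_iff)
    then show "b \<in> ?A" using a(2) deg by (auto simp: dvd_eq_mod_eq_0 intro: degree_mod_less')
  qed
  have img: "?f ` ?A = ?A" using finA inj maps by (intro endo_inj_surj) auto
  have "\<Prod>?A = (\<Prod>p\<in>?A. ?f p)"
    using prod.reindex[OF inj, of "\<lambda>p. p"] img by simp
  then have "\<Prod>?A mod r = (\<Prod>p\<in>?A. ?f p mod r) mod r" by (simp add: mod_prod_eq)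
  also have "\<dots> = (\<Prod>p\<in>?A. ?X * p) mod r" by (simp add: mod_prod_eq)
  also have "(\<Prod>p\<in>?A. ?X * p) = ?X ^ card ?A * \<Prod>?A" by (simp add: prod.distrib)
  finally have "r dvd (?X ^ card ?A - 1) * \<Prod>?A"
    by (simp add: mod_eq_dvd_iff left_diff_distrib dvd_diff_commute)
  \<comment> \<open>Stated for all subsets of \<open>?A\<close>, so that induction over finite sets
    applies.\<close>
  moreover have "\<not> r dvd \<Prod>B" if "B \<subseteq> ?A" for B
    using finite_subset[OF that finA] that
  proof (induction B rule: finite_induct)
    case empty
    then show ?case using prime by (auto simp: prime_elem_def)
  next
    case (insert p B)
    then show ?case using prime small[of p] by (auto simp: prime_elem_dvd_mult_iff)
  qed
  ultimately have "r dvd ?X ^ card ?A - 1"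
    using prime by (meson order_refl prime_elem_dvd_mult_iff)
  moreover have "card ?A = card (UNIV :: 'a set) ^ degree r - 1"
    using card_poly_degree_less[where ?'a = 'a] by (subst card_Diff_singleton) auto
  ultimately show ?thesis by (simp add: monom_power)
qed

section \<open>Polynomials dividing a power of some \<open>X^N - 1\<close>\<close>

lemma monom_diff_1_dvd:
  assumes "a dvd b"
  shows "(monom 1 a - 1 :: 'a::comm_ring_1 poly) dvd monom 1 b - 1"
proof -
  obtain c where c: "b = a * c" using assms by auto
  have "monom 1 b = (monom 1 a :: 'a poly) ^ c" by (simp add: monom_power c)
  then show ?thesis
    by (metis power_diff_1_eq dvd_triv_left)
qed

lemma power_minus_1_dvd_power_minus_1:
  assumes "d dvd l" "0 < q"
  shows "q ^ d - 1 dvd q ^ l - (1::nat)"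
proof -
  obtain c where c: "l = d * c" using assms by auto
  \<comment> \<open>The geometric factorisation needs a ring, hence the passage from natural numbers
    to integers.\<close>
  have "int (q ^ d - 1) dvd int (q ^ l - 1)"
    using assms(2) power_diff_1_eq[of "int q ^ d" c] by (simp add: c power_mult of_nat_diff)
  then show ?thesis by (simp only: of_nat_dvd_iff)
qed

text \<open>\<open>\<sigma>\<close> collects the degrees of the irreducible factors with
  multiplicity. Each factor divides the binomial for the common multiple of all these degrees, and
  the exponent \<open>degree p\<close> accounts for repeated factors.\<close>

lemma poly_dvd_power_monom_diff_1:
  fixes p :: "'a::{field,finite} poly"
  assumes "coeff p 0 \<noteq> 0"
  shows "\<exists>\<sigma>. is_partition_of \<sigma> (degree p) \<and>
    p dvd (monom 1 (card (UNIV :: 'a set) ^ lcm_partition \<sigma> - 1) - 1) ^ degree p"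
  using assms
proof (induction "degree p" arbitrary: p rule: less_induct)
  case less
  let ?q = "card (UNIV :: 'a set)"
  let ?Y = "\<lambda>l. monom 1 (?q ^ l - 1) - 1 :: 'a poly"
  have Ydvd: "?Y d dvd ?Y l" if "d dvd l" for d l
    using that two_le_card_field[where ?'a = 'a]
    by (intro monom_diff_1_dvd power_minus_1_dvd_power_minus_1) auto
  show ?case
  proof (cases "degree p = 0")
    case True
    moreover have "p \<noteq> 0" using less.prems by auto
    ultimately have "p dvd 1" by (simp add: is_unit_iff_degree)
    with True show ?thesis by (intro exI[of _ "{#}"]) (simp add: is_partition_of_def)
  next
    case False
    then obtain r where r: "irreducible r" "r dvd p" "0 < degree r"
      using irreducible_factor_exists[of p] by blast
    obtain t where t: "p = r * t" using r(2) by (elim dvdE)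
    have c: "coeff r 0 \<noteq> 0" "coeff t 0 \<noteq> 0" using less.prems by (auto simp: t coeff_mult_0)
    have deg: "degree p = degree r + degree t"
      unfolding t by (rule degree_mult_eq) (use c in auto)
    obtain \<sigma> where \<sigma>: "is_partition_of \<sigma> (degree t)" "t dvd ?Y (lcm_partition \<sigma>) ^ degree t"
      using less.hyps[of t] deg r(3) c(2) by auto
    let ?\<tau> = "add_mset (degree r) \<sigma>"
    let ?l = "lcm_partition ?\<tau>"
    have "r dvd ?Y (degree r)" using irreducible_dvd_monom_diff_1[OF r(1,3) c(1)] .
    also have "\<dots> dvd ?Y ?l" by (rule Ydvd) (simp add: lcm_partition_def)
    \<comment> \<open>This exponent and the \<open>degree t\<close> of the induction hypothesis add
      up to \<open>degree p\<close>.\<close>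
    also have "\<dots> dvd ?Y ?l ^ degree r" using r(3) by (simp add: dvd_power)
    finally have 1: "r dvd ?Y ?l ^ degree r" .
    have "?Y (lcm_partition \<sigma>) ^ degree t dvd ?Y ?l ^ degree t"
      by (intro dvd_power_same Ydvd) (auto simp: lcm_partition_def)
    with \<sigma>(2) have "t dvd ?Y ?l ^ degree t" by (rule dvd_trans)
    with 1 have "p dvd ?Y ?l ^ degree p"
      unfolding deg power_add by (subst t) (rule mult_dvd_mono)
    moreover have "is_partition_of ?\<tau> (degree p)"
      using \<sigma>(1) r(3) deg by (auto simp: is_partition_of_def)
    ultimately show ?thesis by blast
  qed
qed

section \<open>Univariate sections\<close>

unbundle fps_syntax

definition fps_section :: "nat \<Rightarrow> nat \<Rightarrow> 'b fps \<Rightarrow> 'b fps" where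
  "fps_section q r F = Abs_fps (\<lambda>n. F $ (q * n + r))"

lemma fps_section_nth [simp]: "fps_section q r F $ n = F $ (q * n + r)"
  by (simp add: fps_section_def)

lemma finite_support_fps_eq_sum:
  fixes G :: "'b::comm_ring_1 fps"
  assumes "\<And>i. N < i \<Longrightarrow> G $ i = 0"
  shows "G = (\<Sum>i\<le>N. fps_const (G $ i) * fps_X ^ i)"
  by (rule fps_ext) (use assms in \<open>auto simp: fps_sum_nth fps_X_power_nth if_distrib
        [where f = "(*) _"] not_le cong: if_cong\<close>)

text \<open>Finite support makes \<open>G\<close> a finite sum of monomials, to which Frobenius
  applies termwise. The coefficient ring is left general because it is the field in the univariate
  case and a ring of power series in the bivariate one.\<close>

lemma finite_support_fps_power_nth:
  fixes G :: "'b::comm_ring_1 fps"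
  assumes "\<And>k. 0 < k \<Longrightarrow> k < q \<Longrightarrow> of_nat (q choose k) = (0 :: 'b)" and "0 < q"
    and supp: "\<And>i. N < i \<Longrightarrow> G $ i = 0"
  shows "(G ^ q) $ m = (if q dvd m then (G $ (m div q)) ^ q else 0)"
proof -
  have "of_nat (q choose k) = (0 :: 'b fps)" if "0 < k" "k < q" for k
    using assms(1)[OF that] by (simp flip: fps_of_nat)
  then have "G ^ q = (\<Sum>i\<le>N. (fps_const (G $ i) * fps_X ^ i) ^ q)"
    using frobenius_sum[where 'b = "'b fps" and q = q] assms(2)
      finite_support_fps_eq_sum[of N G, OF supp] by metis
  also have "\<dots> = (\<Sum>i\<le>N. fps_const ((G $ i) ^ q) * fps_X ^ (i * q))"
    by (simp add: power_mult_distrib fps_const_power flip: power_mult)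
  also have "\<dots> $ m = (\<Sum>i\<le>N. if m = i * q then (G $ i) ^ q else 0)"
    by (simp add: fps_sum_nth fps_X_power_nth if_distrib[where f = "(*) _"] cong: if_cong)
  also have "\<dots> = (if q dvd m then (G $ (m div q)) ^ q else 0)"
  proof (cases "q dvd m")
    case True
    then obtain c where c: "m = c * q" by (metis dvdE mult.commute)
    show ?thesis using assms(2) supp[of c] by (auto simp: c power_0_left not_le)
  next
    case False
    then show ?thesis by (auto intro!: sum.neutral)
  qed
  finally show ?thesis .
qed

text \<open>\<open>H\<close> is a series in \<open>X^q\<close>, so only the coefficients of
  \<open>F\<close> at indices congruent to \<open>r\<close> modulo \<open>q\<close> meet a nonzero
  partner.\<close>

lemma fps_mult_nth_stretched:
  fixes F H :: "'b::comm_ring_1 fps"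
  assumes H: "\<And>m. \<not> q dvd m \<Longrightarrow> H $ m = 0" and "r < q"
  shows "(F * H) $ (q * n + r) = (\<Sum>k=0..n. F $ (q * k + r) * H $ (q * (n - k)))"
proof -
  let ?f = "\<lambda>k. q * k + r"
  have inj: "inj_on ?f {0..n}" using assms(2) by (auto simp: inj_on_def)
  have "(F * H) $ (q * n + r) = (\<Sum>i=0..q * n + r. F $ i * H $ (q * n + r - i))"
    by (rule fps_mult_nth)
  also have "\<dots> = (\<Sum>i\<in>?f ` {0..n}. F $ i * H $ (q * n + r - i))"
  proof (rule sum.mono_neutral_right)
    show "\<forall>i\<in>{0..q * n + r} - ?f ` {0..n}. F $ i * H $ (q * n + r - i) = 0"
    proof
      fix i assume i: "i \<in> {0..q * n + r} - ?f ` {0..n}"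
      have "\<not> q dvd q * n + r - i"
      proof
        assume "q dvd q * n + r - i"
        then obtain c where c: "q * n + r - i = q * c" by auto
        with i have e: "q * n + r = q * c + i" by auto
        have "c \<le> n"
        proof (rule ccontr)
          assume "\<not> c \<le> n"
          then have "q * (n + 1) \<le> q * c" by (intro mult_le_mono2) simp
          with e assms(2) show False by simp
        qed
        with e have "i = ?f (n - c)" by (simp add: diff_mult_distrib2)
        with i show False by auto
      qed
      then show "F $ i * H $ (q * n + r - i) = 0" using H by simp
    qed
  qed auto
  also have "\<dots> = (\<Sum>k=0..n. F $ (q * k + r) * H $ (q * n + r - ?f k))"
    by (simp add: sum.reindex[OF inj])
  also have "\<dots> = (\<Sum>k=0..n. F $ (q * k + r) * H $ (q * (n - k)))"
    by (rule sum.cong) (auto simp: diff_mult_distrib2)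
  finally show ?thesis .
qed

text \<open>The projection formula for sections: over the field \<open>G^q\<close> is
  \<open>G(X^q)\<close>, and a series in \<open>X^q\<close> can be taken out of a section.\<close>

lemma fps_section_mult_power:
  fixes F G :: "'a::{field,finite} fps"
  assumes q: "q = card (UNIV :: 'a set)" and "r < q" and "\<And>i. N < i \<Longrightarrow> G $ i = 0"
  shows "fps_section q r (F * G ^ q) = fps_section q r F * G"
proof (rule fps_ext)
  fix n
  have G: "(G ^ q) $ m = (if q dvd m then G $ (m div q) else 0)" for m
    using finite_support_fps_power_nth[where N = N and G = G and q = q]
      of_nat_card_choose_eq_0[where ?'a = 'a] assms finite_field_power_card
    by (metis gr_zeroI not_less_zero)
  have "fps_section q r (F * G ^ q) $ n
      = (\<Sum>k=0..n. F $ (q * k + r) * (G ^ q) $ (q * (n - k)))"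
    unfolding fps_section_nth by (rule fps_mult_nth_stretched) (use assms G in auto)
  also have "\<dots> = (fps_section q r F * G) $ n"
    using assms(2) by (simp add: G fps_mult_nth)
  finally show "fps_section q r (F * G ^ q) $ n = (fps_section q r F * G) $ n" .
qed

lemma fps_section_sum: "fps_section q r (\<Sum>i\<in>I. f i) = (\<Sum>i\<in>I. fps_section q r (f i))"
  by (rule fps_ext) (simp add: fps_sum_nth)

text \<open>Both variables get the same residue \<open>r\<close>: the diagonal only looks at the
  positions \<open>(q * n + r, q * n + r)\<close>.\<close>

definition fps2_section :: "nat \<Rightarrow> nat \<Rightarrow> 'b fps fps \<Rightarrow> 'b fps fps" where
  "fps2_section q r F = Abs_fps (\<lambda>n. fps_section q r (F $ (q * n + r)))"

lemma fps2_section_nth [simp]: "fps2_section q r F $ n = fps_section q r (F $ (q * n + r))"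
  by (simp add: fps2_section_def)

text \<open>The projection formula is used twice: in the outer variable, where the coefficients of
  \<open>G ^ q\<close> are \<open>q\<close>-th powers of univariate series, and then in the inner
  variable for each of them.\<close>

lemma fps2_section_mult_power:
  fixes F G :: "'a::{field,finite} fps fps"
  assumes q: "q = card (UNIV :: 'a set)" and "r < q"
    and N: "\<And>i. N < i \<Longrightarrow> G $ i = 0" and M: "\<And>i j. M < j \<Longrightarrow> G $ i $ j = 0"
  shows "fps2_section q r (F * G ^ q) = fps2_section q r F * G"
proof (rule fps_ext)
  fix n
  have "of_nat (q choose k) = (0 :: 'a fps)" if "0 < k" "k < q" for k
    using of_nat_card_choose_eq_0[of k, where ?'a = 'a] that q by (simp flip: fps_of_nat)
  then have G: "(G ^ q) $ m = (if q dvd m then (G $ (m div q)) ^ q else 0)" for m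
    using finite_support_fps_power_nth[where N = N and G = G and q = q] N assms(2)
    by (metis gr_zeroI not_less_zero)
  have "fps2_section q r (F * G ^ q) $ n
      = fps_section q r (\<Sum>k=0..n. F $ (q * k + r) * (G ^ q) $ (q * (n - k)))"
    unfolding fps2_section_nth by (subst fps_mult_nth_stretched) (use assms G in auto)
  also have "\<dots> = (\<Sum>k=0..n. fps_section q r (F $ (q * k + r)) * G $ (n - k))"
    using assms(2) by (simp add: G fps_section_sum fps_section_mult_power[OF q _ M])
  also have "\<dots> = (fps2_section q r F * G) $ n"
    by (simp add: fps_mult_nth)
  finally show "fps2_section q r (F * G ^ q) $ n = (fps2_section q r F * G) $ n" .
qed

text \<open>The action of the section on numerators: as \<open>S/R = S R^(q-1) / R^q\<close>, the
  section of \<open>S/R\<close> for residue \<open>0\<close> has numerator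
  \<open>cartier q R S\<close> over the same \<open>R\<close>.\<close>

definition cartier :: "nat \<Rightarrow> 'b::comm_ring_1 fps \<Rightarrow> 'b fps \<Rightarrow> 'b fps" where
  "cartier q R S = fps_section q 0 (S * R ^ (q - 1))"

lemma finite_support_fps_poly:
  fixes R :: "'a::comm_ring_1 fps"
  assumes "\<And>i. n < i \<Longrightarrow> R $ i = 0"
  obtains p where "fps_of_poly p = R" "degree p \<le> n"
proof
  let ?p = "\<Sum>i\<le>n. monom (R $ i) i"
  show "fps_of_poly ?p = R"
    by (rule fps_ext) (use assms in \<open>auto simp: coeff_sum not_le\<close>)
  show "degree ?p \<le> n"
    by (rule degree_sum_le) (auto intro: order_trans[OF degree_monom_le])
qed

text \<open>With \<open>R = X^k \<rho>\<close> and \<open>B = S / \<rho>\<close>, the iterates are read off the Laurent series \<open>S / R\<close>;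
  the index is shifted by \<open>k\<close> and computed in the integers, negative indices giving 0.\<close>

lemma cartier_funpow:
  fixes \<rho> B S :: "'a::{field,finite} fps"
  assumes q: "q = card (UNIV :: 'a set)" and \<rho>: "\<And>i. N < i \<Longrightarrow> \<rho> $ i = 0" and B: "B * \<rho> = S"
  shows "(cartier q (fps_X ^ k * \<rho>) ^^ e) S = \<rho> * Abs_fps (\<lambda>j.
    let i = int q ^ e * (int j - int k) + int k in if i < 0 then 0 else B $ nat i)"
proof (induction e)
  case 0
  have "Abs_fps (\<lambda>j. B $ j) = B" by (rule fps_ext) simp
  then show ?case using B by (simp add: Let_def mult.commute)
next
  case (Suc e)
  let ?b = "\<lambda>i. if i < 0 then 0 else B $ nat i"
  let ?G = "\<lambda>e. Abs_fps (\<lambda>j. ?b (int q ^ e * (int j - int k) + int k))"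
  have q2: "2 \<le> q" unfolding q by (rule two_le_card_field)
  \<comment> \<open>The factors \<open>\<rho>\<close> combine to a full \<open>q\<close>-th power,
    which leaves the section as \<open>\<rho>\<close>; the power of \<open>fps_X\<close> remains
    inside as an index shift.\<close>
  have "\<rho> * ?G e * (fps_X ^ k * \<rho>) ^ (q - 1) = ?G e * fps_X ^ (k * (q - 1)) * (\<rho> * \<rho> ^ (q - 1))"
    by (simp add: power_mult_distrib mult_ac flip: power_mult)
  also have "\<rho> * \<rho> ^ (q - 1) = \<rho> ^ q" using q2 by (simp flip: power_Suc)
  finally have "cartier q (fps_X ^ k * \<rho>) (\<rho> * ?G e)
      = fps_section q 0 (?G e * fps_X ^ (k * (q - 1)) * \<rho> ^ q)"
    by (simp only: cartier_def)
  also have "\<dots> = fps_section q 0 (?G e * fps_X ^ (k * (q - 1))) * \<rho>"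
    by (rule fps_section_mult_power[OF q _ \<rho>]) (use q2 in auto)
  finally have "cartier q (fps_X ^ k * \<rho>) (\<rho> * ?G e)
      = fps_section q 0 (?G e * fps_X ^ (k * (q - 1))) * \<rho>" .
  moreover have "fps_section q 0 (?G e * fps_X ^ (k * (q - 1))) = ?G (Suc e)"
  proof (rule fps_ext)
    fix j
    show "fps_section q 0 (?G e * fps_X ^ (k * (q - 1))) $ j = ?G (Suc e) $ j"
    \<comment> \<open>Below the shift the coefficient is \<open>0\<close>, so the integer index on
      the right must turn out negative; otherwise both indices agree.\<close>
    proof (cases "q * j < k * (q - 1)")
      case True
      have "int (q * j) < int (k * (q - 1))" using True by (simp only: of_nat_less_iff)
      then have "int q * int j < int k * (int q - 1)"
        using q2 by (simp add: of_nat_diff)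
      then have "int q * (int j - int k) \<le> - int k - 1" by (simp add: algebra_simps)
      moreover from this have "int j - int k \<le> 0"
        using q2 by (smt (verit) mult_nonneg_nonneg of_nat_0_le_iff)
      ultimately have "int q ^ e * (int q * (int j - int k)) \<le> 1 * (int q * (int j - int k))"
        using q2 by (intro mult_right_mono_neg) auto
      then have "int q ^ Suc e * (int j - int k) + int k < 0"
        using \<open>int q * (int j - int k) \<le> - int k - 1\<close> by (simp add: mult_ac)
      with True show ?thesis by (simp add: fps_X_power_mult_right_nth)
    next
      case False
      then have "int (q * j - k * (q - 1)) - int k = int q * (int j - int k)"
        using q2 by (simp add: of_nat_diff algebra_simps)
      then have "int q ^ e * (int (q * j - k * (q - 1)) - int k) = int q ^ Suc e * (int j - int k)"
        by simp
      then have "?G e $ (q * j - k * (q - 1)) = ?G (Suc e) $ j"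
        by (simp only: fps_nth_Abs_fps)
      with False show ?thesis
        by (simp only: fps_section_nth add_0_right fps_X_power_mult_right_nth if_False)
    qed
  qed
  ultimately have "cartier q (fps_X ^ k * \<rho>) (\<rho> * ?G e) = \<rho> * ?G (Suc e)"
    by (simp only: mult.commute)
  then show ?case using Suc.IH by (simp only: Let_def funpow.simps comp_apply)
qed

text \<open>The condition \<open>n < q ^ s\<close> serves twice: it makes the exponent
  \<open>q ^ s\<close> large enough for \<open>\<rho>\<close> to divide the binomial, and after
  \<open>s\<close> steps it moves every index other than \<open>k\<close> below \<open>0\<close> or
  beyond the preperiod of \<open>S / \<rho>\<close>.\<close>

lemma cartier_eventually_periodic:
  fixes R S :: "'a::{field,finite} fps"
  assumes q: "q = card (UNIV :: 'a set)" and n: "1 \<le> n" "n < q ^ s"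
    and R: "\<And>i. n < i \<Longrightarrow> R $ i = 0" and S: "\<And>i. n < i \<Longrightarrow> S $ i = 0"
  shows "\<exists>\<sigma>\<in>partitions_upto n.
    (cartier q R ^^ (s + lcm_partition \<sigma>)) S = (cartier q R ^^ s) S"
proof (cases "R = 0")
  case True
  have q2: "2 \<le> q" unfolding q by (rule two_le_card_field)
  \<comment> \<open>For \<open>R = 0\<close> the operator is zero, so the orbit is constant from the
    first step on and the period \<open>1\<close> of \<open>{#1#}\<close> will do.\<close>
  have "s \<noteq> 0" using n by (auto intro: ccontr)
  have 0: "cartier q R T = 0" for T
    using True q2 by (auto simp: cartier_def fps_section_def power_0_left intro: fps_ext)
  have "(cartier q R ^^ m) S = 0" if "m \<noteq> 0" for m
    using that 0 by (cases m) auto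
  with \<open>s \<noteq> 0\<close> n show ?thesis
    by (intro bexI[of _ "{#1#}"]) (auto simp: partitions_upto_def is_partition_of_def)
next
  case False
  have q2: "2 \<le> q" unfolding q by (rule two_le_card_field)
  obtain p where p: "fps_of_poly p = R" "degree p \<le> n"
    using finite_support_fps_poly[OF R] by blast
  with False have "p \<noteq> 0" by auto
  \<comment> \<open>The polynomial \<open>[:- 0, 1:]\<close> is \<open>X\<close>, written as the
    linear factor at the root \<open>0\<close>.\<close>
  then obtain \<rho> where \<rho>: "p = [:- 0, 1:] ^ order 0 p * \<rho>" "\<not> [:- 0, 1:] dvd \<rho>"
    using order_decomp by blast
  define k where "k = order 0 p"
  have p_eq: "p = monom 1 k * \<rho>" using \<rho>(1) by (simp add: k_def monom_altdef)
  have \<rho>0: "coeff \<rho> 0 \<noteq> 0" using \<rho>(2) by (simp add: dvd_iff_poly_eq_0 poly_0_coeff_0)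
  have deg: "degree p = k + degree \<rho>"
    unfolding p_eq by (subst degree_mult_eq) (use \<rho>0 in \<open>auto simp: degree_monom_eq\<close>)
  have kn: "k \<le> n" "degree \<rho> \<le> n" using deg p(2) by auto
  have R_eq: "R = fps_X ^ k * fps_of_poly \<rho>"
    using p(1) by (simp add: p_eq fps_of_poly_mult fps_of_poly_monom')
  define B where "B = S * inverse (fps_of_poly \<rho>)"
  have B: "B * fps_of_poly \<rho> = S"
    using inverse_mult_eq_1[of "fps_of_poly \<rho>"] \<rho>0 by (simp add: B_def mult.assoc)
  obtain \<sigma> where \<sigma>: "is_partition_of \<sigma> (degree \<rho>)"
      "\<rho> dvd (monom 1 (q ^ lcm_partition \<sigma> - 1) - 1) ^ degree \<rho>"
    using poly_dvd_power_monom_diff_1[OF \<rho>0] q by blast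
  define l where "l = lcm_partition \<sigma>"
  \<comment> \<open>By Frobenius \<open>(X^(q^l-1) - 1)^(q^s) = X^M - 1\<close>, so \<open>M\<close>
    is a period of the coefficients of \<open>B\<close>.\<close>
  define M where "M = (q ^ l - 1) * q ^ s"
  have binom: "of_nat (q choose k) = (0 :: 'a poly)" if "0 < k" "k < q" for k
    using of_nat_card_choose_eq_0[of k, where ?'a = 'a] that q by (simp add: of_nat_poly)
  have "(monom 1 (q ^ l - 1) - 1 :: 'a poly) ^ degree \<rho> dvd (monom 1 (q ^ l - 1) - 1) ^ (q ^ s)"
    using kn n by (intro le_imp_power_dvd) auto
  also have "\<dots> = monom 1 M - 1"
    using frobenius_power_diff_1[OF binom] q2 by (simp add: monom_power M_def)
  finally have "\<rho> dvd monom 1 M - 1"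
    using \<sigma>(2) unfolding l_def by (rule dvd_trans[rotated])
  then obtain U where U: "monom 1 M - 1 = \<rho> * U" by (elim dvdE)
  have degU: "degree U \<le> M"
  proof (cases "U = 0")
    case False
    have "degree U \<le> degree (\<rho> * U)" using False \<rho>0 by (subst degree_mult_eq) auto
    also have "\<dots> \<le> M" unfolding U[symmetric]
      by (rule degree_diff_le) (auto simp: degree_monom_le)
    finally show ?thesis .
  qed simp
  \<comment> \<open>Multiplying by \<open>X^M - 1\<close> clears the denominator of \<open>B\<close>
    and leaves the polynomial \<open>S U\<close> of degree at most \<open>n + M\<close>; hence
    \<open>B\<close> repeats beyond index \<open>n\<close>.\<close>
  have BU: "B * (fps_X ^ M - 1) = S * fps_of_poly U"
  proof -
    have "fps_X ^ M - 1 = fps_of_poly (\<rho> * U)"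
      unfolding U[symmetric] by (simp add: fps_of_poly_monom' fps_of_poly_diff)
    then have "B * (fps_X ^ M - 1) = B * fps_of_poly \<rho> * fps_of_poly U"
      by (simp only: fps_of_poly_mult mult.assoc)
    then show ?thesis by (simp only: B)
  qed
  have per1: "B $ (i + M) = B $ i" if "n < i" for i
  proof -
    have "(S * fps_of_poly U) $ (i + M) = 0"
      unfolding fps_mult_nth
    proof (rule sum.neutral, intro ballI)
      fix j assume "j \<in> {0..i + M}"
      have "S $ j = 0 \<or> degree U < i + M - j" using S that degU by (cases "n < j") auto
      then show "S $ j * fps_of_poly U $ (i + M - j) = 0" by (auto simp: coeff_eq_0)
    qed
    then show ?thesis unfolding BU[symmetric]
      by (simp add: right_diff_distrib fps_X_power_mult_right_nth)
  qed
  have per: "B $ (i + M * c) = B $ i" if "n < i" for i c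
  proof (induction c)
    case (Suc c)
    have "B $ (i + M * c + M) = B $ (i + M * c)" using that by (intro per1) simp
    then show ?case using Suc by (simp add: algebra_simps)
  qed simp
  have "(cartier q R ^^ (s + l)) S = (cartier q R ^^ s) S"
  proof -
    let ?b = "\<lambda>i. if i < 0 then 0 else B $ nat i"
    have "?b (int q ^ (s + l) * (int j - int k) + int k) = ?b (int q ^ s * (int j - int k) + int k)"
      for j
    proof -
      \<comment> \<open>For \<open>j < k\<close> both indices are negative, for \<open>j = k\<close>
        both are \<open>k\<close>, and for \<open>k < j\<close> they exceed \<open>n\<close> and
        differ by a multiple of \<open>M\<close>.\<close>
      consider "j < k" | "j = k" | "k < j" by linarith
      then show ?thesis
      proof cases
        case 1
        have neg: "int q ^ e * (int j - int k) + int k < 0" if "s \<le> e" for e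
        proof -
          have "q ^ s \<le> q ^ e" using that q2 by (intro power_increasing) auto
          then have "int k < int (q ^ e)" using n kn by simp
          then have "int k < int q ^ e" by (simp only: of_nat_power)
          moreover have "int q ^ e * (int j - int k) \<le> int q ^ e * (- 1)"
            using 1 by (intro mult_left_mono) auto
          ultimately show ?thesis by linarith
        qed
        show ?thesis using neg[of s] neg[of "s + l"] by simp
      next
        case 3
        define c where "c = j - k"
        have jc: "int j - int k = int c" "1 \<le> c" using 3 by (auto simp: c_def)
        define i where "i = q ^ s * c + k"
        have "q ^ s * 1 \<le> q ^ s * c" using jc by (intro mult_left_mono) auto
        then have "n < i" using n unfolding i_def by linarith
        have "q ^ l = (q ^ l - 1) + 1" using q2 by simp
        then have "q ^ (s + l) * c + k = i + M * c"
          unfolding i_def M_def power_add by (metis (no_types, opaque_lifting) add.assoc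
            add.commute distrib_left distrib_right mult.assoc mult.commute mult_1)
        then have "int q ^ (s + l) * int c + int k = int (i + M * c)"
          by (metis of_nat_add of_nat_mult of_nat_power)
        moreover have "int q ^ s * int c + int k = int i" by (simp add: i_def)
        moreover have "?b (int m) = B $ m" for m by simp
        ultimately show ?thesis using per[OF \<open>n < i\<close>, of c] by (simp only: jc(1))
      qed simp
    qed
    then show ?thesis
      using cartier_funpow[OF q _ B, where k = k and N = "degree \<rho>", folded R_eq]
      by (simp add: Let_def coeff_eq_0)
  qed
  \<comment> \<open>A constant \<open>\<rho>\<close> yields the empty partition of \<open>0\<close>,
    which \<open>partitions_upto\<close> excludes; \<open>{#1#}\<close> has the same least common
    multiple.\<close>
  moreover have "\<exists>\<tau>\<in>partitions_upto n. lcm_partition \<tau> = l"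
  proof (cases "degree \<rho> = 0")
    case True
    then have "\<sigma> = {#}" using \<sigma>(1) by (auto simp: is_partition_of_def intro: multiset_cases)
    then show ?thesis using n by (intro bexI[of _ "{#1#}"])
      (auto simp: l_def lcm_partition_def partitions_upto_def is_partition_of_def)
  next
    case False
    then show ?thesis using \<sigma>(1) kn
      by (intro bexI[of _ \<sigma>]) (auto simp: l_def partitions_upto_def)
  qed
  ultimately show ?thesis by metis
qed

section \<open>Bivariate sections\<close>

text \<open>The first bound is for the degree in \<open>x\<close>, the inner index, and the second
  for the degree in \<open>y\<close>. Numerators stay series of bounded support, so they share a
  type with the quotients.\<close>

definition fps2_box :: "nat \<Rightarrow> nat \<Rightarrow> 'b::zero fps fps set" where
  "fps2_box h d = {F. \<forall>n m. F $ n $ m \<noteq> 0 \<longrightarrow> n \<le> d \<and> m \<le> h}"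

lemma fps2_boxD:
  assumes "F \<in> fps2_box h d"
  shows "d < n \<Longrightarrow> F $ n = 0" and "h < m \<Longrightarrow> F $ n $ m = 0"
proof -
  show "F $ n $ m = 0" if "h < m" for n m
    using assms that unfolding fps2_box_def by (auto dest: leD)
  show "F $ n = 0" if "d < n"
    by (rule fps_ext) (use assms that in \<open>auto simp: fps2_box_def dest: leD\<close>)
qed

lemma fps2_mult_nth:
  fixes F G :: "'b::comm_ring_1 fps fps"
  shows "(F * G) $ n $ m = (\<Sum>i=0..n. \<Sum>j=0..m. F $ i $ j * G $ (n - i) $ (m - j))"
  by (simp add: fps_mult_nth fps_sum_nth)

lemma fps2_box_mult:
  fixes F G :: "'b::comm_ring_1 fps fps"
  assumes "F \<in> fps2_box a b" "G \<in> fps2_box a' b'"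
  shows "F * G \<in> fps2_box (a + a') (b + b')"
  unfolding fps2_box_def
proof (intro CollectI allI impI)
  fix n m assume nz: "(F * G) $ n $ m \<noteq> 0"
  have "\<exists>i\<in>{0..n}. \<exists>j\<in>{0..m}. F $ i $ j * G $ (n - i) $ (m - j) \<noteq> 0"
    using nz unfolding fps2_mult_nth by (meson sum.neutral)
  then obtain i j where ij: "i \<le> n" "j \<le> m" "F $ i $ j \<noteq> 0" "G $ (n - i) $ (m - j) \<noteq> 0"
    by (metis atLeastAtMost_iff mult_zero_left mult_zero_right)
  then have "i \<le> b \<and> j \<le> a" "n - i \<le> b' \<and> m - j \<le> a'"
    using assms unfolding fps2_box_def by blast+
  with ij show "n \<le> b + b' \<and> m \<le> a + a'" by linarith
qed

lemma fps2_box_power: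
  fixes F :: "'b::comm_ring_1 fps fps"
  assumes "F \<in> fps2_box a b"
  shows "F ^ k \<in> fps2_box (k * a) (k * b)"
proof (induction k)
  case 0
  show ?case by (auto simp: fps2_box_def fps_one_nth split: if_splits)
next
  case (Suc k)
  then show ?case using fps2_box_mult[OF assms] by simp
qed

lemma fps2_box_section:
  assumes "F \<in> fps2_box a b"
    and "\<And>m. q * m + r \<le> a \<Longrightarrow> m \<le> a'" "\<And>m. q * m + r \<le> b \<Longrightarrow> m \<le> b'"
  shows "fps2_section q r F \<in> fps2_box a' b'"
  using assms by (auto simp: fps2_box_def)

definition cartier2 :: "nat \<Rightarrow> nat \<Rightarrow> 'b::comm_ring_1 fps fps \<Rightarrow> 'b fps fps \<Rightarrow> 'b fps fps" where
  "cartier2 q r Q S = fps2_section q r (S * Q ^ (q - 1))"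

text \<open>\<open>S Q^(q-1)\<close> has degree at most \<open>q h\<close> in \<open>x\<close>, and
  \<open>q m + r \<le> q h\<close> forces \<open>m \<le> h\<close>, strictly if
  \<open>0 < r\<close>. From the smaller box the degree is below \<open>q h\<close>, so
  \<open>m < h\<close> for every \<open>r\<close>. The same holds for \<open>y\<close> and
  \<open>d\<close>.\<close>

lemma cartier2_fps2_box:
  fixes Q S :: "'b::comm_ring_1 fps fps"
  assumes q: "2 \<le> q" and Q: "Q \<in> fps2_box h d"
  shows "S \<in> fps2_box h d \<Longrightarrow> cartier2 q r Q S \<in> fps2_box h d"
    and "S \<in> fps2_box h d \<Longrightarrow> 0 < r \<Longrightarrow> cartier2 q r Q S \<in> fps2_box (h - 1) (d - 1)"
    and "S \<in> fps2_box (h - 1) (d - 1) \<Longrightarrow> 1 \<le> h \<Longrightarrow> 1 \<le> d \<Longrightarrow>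
      cartier2 q r Q S \<in> fps2_box (h - 1) (d - 1)"
proof -
  have e: "k + (q - 1) * k = q * k" for k using q by (cases q) auto
  have le: "m \<le> k" if "q * m + r \<le> q * k" for m k
  proof -
    have "q * m \<le> q * k" using that by linarith
    then show ?thesis using q mult_le_cancel1[of q m k] by auto
  qed
  have less: "m \<le> k - 1" if "q * m + r < q * k" for m k r
  proof -
    have "q * m < q * k" using that by linarith
    then have "m < k" by simp
    then show ?thesis by linarith
  qed
  show "cartier2 q r Q S \<in> fps2_box h d" if S: "S \<in> fps2_box h d"
    unfolding cartier2_def
    using fps2_box_mult[OF S fps2_box_power[OF Q, of "q - 1"]] unfolding e
    by (rule fps2_box_section) (auto intro: le)
  show "cartier2 q r Q S \<in> fps2_box (h - 1) (d - 1)" if S: "S \<in> fps2_box h d" and "0 < r"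
    unfolding cartier2_def
    using fps2_box_mult[OF S fps2_box_power[OF Q, of "q - 1"]] unfolding e
  proof (rule fps2_box_section)
    \<comment> \<open>Since \<open>0 < r\<close>, the weak inequality for \<open>r\<close> is the
      strict one for \<open>r - 1\<close>.\<close>
    fix m show "m \<le> h - 1" if "q * m + r \<le> q * h" using less[of m "r - 1" h] \<open>0 < r\<close> that by simp
  next
    fix m show "m \<le> d - 1" if "q * m + r \<le> q * d" using less[of m "r - 1" d] \<open>0 < r\<close> that by simp
  qed
  show "cartier2 q r Q S \<in> fps2_box (h - 1) (d - 1)"
    if S: "S \<in> fps2_box (h - 1) (d - 1)" and hd: "1 \<le> h" "1 \<le> d"
    unfolding cartier2_def
    using fps2_box_mult[OF S fps2_box_power[OF Q, of "q - 1"]]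
  proof (rule fps2_box_section)
    fix m show "m \<le> h - 1" if "q * m + r \<le> h - 1 + (q - 1) * h"
      using less[of m r h] e[of h] hd that by simp
  next
    fix m show "m \<le> d - 1" if "q * m + r \<le> d - 1 + (q - 1) * d"
      using less[of m r d] e[of d] hd that by simp
  qed
qed

text \<open>Writing \<open>S/Q\<close> as \<open>S Q^(q-1) / Q^q\<close> lets the projection formula
  keep the denominator \<open>Q\<close>; only the numerator changes.\<close>

lemma fps2_section_quotient:
  fixes Q S I :: "'a::{field,finite} fps fps"
  assumes q: "q = card (UNIV :: 'a set)" and "r < q" and Q: "Q \<in> fps2_box h d" and I: "Q * I = 1"
  shows "fps2_section q r (S * I) = cartier2 q r Q S * I"
proof -
  have "q = Suc (q - 1)" using assms(2) by simp
  then have "Q ^ q = Q * Q ^ (q - 1)" by (metis power_Suc)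
  then have "S * I * Q ^ q = Q * I * (S * Q ^ (q - 1))" by (simp only: mult_ac)
  then have "fps2_section q r (S * Q ^ (q - 1)) = fps2_section q r (S * I * Q ^ q)"
    by (simp only: I mult_1)
  also have "\<dots> = fps2_section q r (S * I) * Q"
    by (rule fps2_section_mult_power[OF q assms(2)]) (use fps2_boxD[OF Q] in auto)
  finally show ?thesis by (simp add: cartier2_def mult.assoc I)
qed

text \<open>The numerators form an automaton: the orbit of \<open>P\<close> together with the
  smaller box is closed under all residues, and the base \<open>q\<close> digits of \<open>r\<close>
  are read from the lowest upwards.\<close>

lemma q_kernel_subset_states:
  fixes Q P I :: "'a::{field,finite} fps fps"
  assumes q: "q = card (UNIV :: 'a set)" and Q: "Q \<in> fps2_box h d" and P: "P \<in> fps2_box h d"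
    and I: "Q * I = 1" and hd: "1 \<le> h" "1 \<le> d" and a: "\<And>n. a n = (P * I) $ n $ n"
  shows "q_kernel q a \<subseteq> (\<lambda>S n. (S * I) $ n $ n) `
    (range (\<lambda>e. (cartier2 q 0 Q ^^ e) P) \<union> fps2_box (h - 1) (d - 1))"
proof -
  let ?O = "range (\<lambda>e. (cartier2 q 0 Q ^^ e) P)" and ?V = "fps2_box (h - 1) (d - 1)"
  have q2: "2 \<le> q" unfolding q by (rule two_le_card_field)
  have O: "?O \<subseteq> fps2_box h d"
  proof -
    have "(cartier2 q 0 Q ^^ e) P \<in> fps2_box h d" for e
      by (induction e) (use P cartier2_fps2_box(1)[OF q2 Q] in auto)
    then show ?thesis by blast
  qed
  have closed: "cartier2 q r Q S \<in> ?O \<union> ?V" if "S \<in> ?O \<union> ?V" for S r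
  proof (cases "S \<in> ?V")
    case True
    then show ?thesis using cartier2_fps2_box(3)[OF q2 Q] hd by blast
  next
    case False
    with that obtain e where e: "S = (cartier2 q 0 Q ^^ e) P" by auto
    show ?thesis
    proof (cases "r = 0")
      case True
      then have "cartier2 q r Q S = (cartier2 q 0 Q ^^ Suc e) P" by (simp add: e)
      then show ?thesis by blast
    next
      case False
      then show ?thesis using cartier2_fps2_box(2)[OF q2 Q] O e by blast
    qed
  qed
  have "\<exists>S\<in>?O \<union> ?V. \<forall>n. a (q ^ e * n + r) = (S * I) $ n $ n" if "r < q ^ e" for e r
    using that
  proof (induction e arbitrary: r)
    case 0
    have "P \<in> ?O" by (rule range_eqI[of _ _ 0]) simp
    with 0 show ?case using a by (intro bexI[of _ P]) auto
  next
    case (Suc e)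
    \<comment> \<open>\<open>r1\<close> is the leading digit of \<open>r\<close>; it is read last,
      by substituting \<open>q * n + r1\<close> for \<open>n\<close>.\<close>
    define r0 r1 where "r0 = r mod q ^ e" and "r1 = r div q ^ e"
    have r: "r = q ^ e * r1 + r0" "r0 < q ^ e" using q2 by (auto simp: r0_def r1_def)
    have r1: "r1 < q"
      using Suc.prems q2 unfolding r1_def by (simp add: less_mult_imp_div_less)
    obtain S where S: "S \<in> ?O \<union> ?V" "\<And>n. a (q ^ e * n + r0) = (S * I) $ n $ n"
      using Suc.IH[OF r(2)] by blast
    have "a (q ^ Suc e * n + r) = (cartier2 q r1 Q S * I) $ n $ n" for n
    proof -
      have "q ^ Suc e * n + r = q ^ e * (q * n + r1) + r0" by (simp add: r(1) algebra_simps)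
      then have "a (q ^ Suc e * n + r) = fps2_section q r1 (S * I) $ n $ n" by (simp add: S(2))
      then show ?thesis by (simp add: fps2_section_quotient[OF q r1 Q I])
    qed
    then show ?case using closed[OF S(1)] by blast
  qed
  then have ex: "\<exists>S\<in>?O \<union> ?V. (\<lambda>n. a (q ^ e * n + r)) = (\<lambda>n. (S * I) $ n $ n)"
    if "r < q ^ e" for e r using that by (simp add: fun_eq_iff)
  show ?thesis
  proof
    fix b assume "b \<in> q_kernel q a"
    then obtain e r where b: "b = (\<lambda>n. a (q ^ e * n + r))" "r \<le> q ^ e - 1"
      by (auto simp: q_kernel_def)
    have "0 < q ^ e" using q2 by simp
    with b(2) have "r < q ^ e" by linarith
    then show "b \<in> (\<lambda>S n. (S * I) $ n $ n) ` (?O \<union> ?V)" using ex b(1) by blast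
  qed
qed

section \<open>The four edges of the box\<close>

text \<open>The cases \<open>t = 0\<close> and \<open>t = 1\<close> are the lowest and the highest coefficient.\<close>

lemma fps_mult_nth_extreme:
  fixes F G :: "'b::comm_ring_1 fps"
  assumes F: "\<And>i. a < i \<Longrightarrow> F $ i = 0" and G: "\<And>i. b < i \<Longrightarrow> G $ i = 0"
    and t: "t = 0 \<or> t = 1"
  shows "(F * G) $ (t * (a + b)) = F $ (t * a) * G $ (t * b)"
  using t
proof
  assume t: "t = 1"
  have "(\<Sum>i=0..a + b. F $ i * G $ (a + b - i)) = (\<Sum>i\<in>{a}. F $ i * G $ (a + b - i))"
  proof (rule sum.mono_neutral_right)
    show "\<forall>i\<in>{0..a + b} - {a}. F $ i * G $ (a + b - i) = 0"
    proof
      fix i assume "i \<in> {0..a + b} - {a}"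
      then have "a < i \<or> b < a + b - i" by auto
      then show "F $ i * G $ (a + b - i) = 0" using F G by auto
    qed
  qed auto
  then show ?thesis by (simp add: t fps_mult_nth)
qed (simp add: fps_mult_nth)

definition fps2_column :: "nat \<Rightarrow> 'b fps fps \<Rightarrow> 'b fps" where
  "fps2_column m F = Abs_fps (\<lambda>n. F $ n $ m)"

lemma fps2_column_nth [simp]: "fps2_column m F $ n = F $ n $ m"
  by (simp add: fps2_column_def)

lemma fps2_row_mult:
  fixes F G :: "'b::comm_ring_1 fps fps"
  assumes F: "F \<in> fps2_box a b" and G: "G \<in> fps2_box a' b'" and t: "t = 0 \<or> t = 1"
  shows "(F * G) $ (t * (b + b')) = F $ (t * b) * G $ (t * b')"
  by (rule fps_mult_nth_extreme[OF _ _ t]) (use fps2_boxD[OF F] fps2_boxD[OF G] in auto)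

lemma fps2_column_mult:
  fixes F G :: "'b::comm_ring_1 fps fps"
  assumes F: "F \<in> fps2_box a b" and G: "G \<in> fps2_box a' b'" and t: "t = 0 \<or> t = 1"
  shows "fps2_column (t * (a + a')) (F * G) = fps2_column (t * a) F * fps2_column (t * a') G"
proof (rule fps_ext)
  fix n
  have "(F $ i * G $ j) $ (t * (a + a')) = F $ i $ (t * a) * G $ j $ (t * a')" for i j
    by (rule fps_mult_nth_extreme[OF _ _ t]) (use fps2_boxD[OF F] fps2_boxD[OF G] in auto)
  then show "fps2_column (t * (a + a')) (F * G) $ n
      = (fps2_column (t * a) F * fps2_column (t * a') G) $ n"
    by (simp add: fps_mult_nth[of F] fps_mult_nth[of "fps2_column _ _"] fps_sum_nth
      del: fps_mult_nth_0)
qed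

lemma fps2_row_power:
  fixes F :: "'b::comm_ring_1 fps fps"
  assumes F: "F \<in> fps2_box a b" and t: "t = 0 \<or> t = 1"
  shows "(F ^ k) $ (t * (k * b)) = (F $ (t * b)) ^ k"
proof (induction k)
  case (Suc k)
  have "(F ^ Suc k) $ (t * (Suc k * b)) = F $ (t * b) * (F ^ k) $ (t * (k * b))"
    using fps2_row_mult[OF F fps2_box_power[OF F] t, of k] by simp
  with Suc show ?case by simp
qed simp

lemma fps2_column_power:
  fixes F :: "'b::comm_ring_1 fps fps"
  assumes F: "F \<in> fps2_box a b" and t: "t = 0 \<or> t = 1"
  shows "fps2_column (t * (k * a)) (F ^ k) = fps2_column (t * a) F ^ k"
proof (induction k)
  case 0
  show ?case by (rule fps_ext) (simp add: fps_one_nth)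
next
  case (Suc k)
  have "fps2_column (t * (Suc k * a)) (F ^ Suc k)
      = fps2_column (t * a) F * fps2_column (t * (k * a)) (F ^ k)"
    using fps2_column_mult[OF F fps2_box_power[OF F] t, of k] by simp
  with Suc show ?case by simp
qed

text \<open>In \<open>S Q^(q-1)\<close> the extreme rows are products of extreme rows, at heights
  \<open>0\<close> and \<open>q * d\<close>. The section for residue \<open>0\<close> moves them to
  \<open>0\<close> and \<open>d\<close>, so each edge evolves on its own.\<close>

lemma cartier2_row:
  fixes Q S :: "'b::comm_ring_1 fps fps"
  assumes q: "2 \<le> q" and Q: "Q \<in> fps2_box h d" and S: "S \<in> fps2_box h d" and t: "t = 0 \<or> t = 1"
  shows "cartier2 q 0 Q S $ (t * d) = cartier q (Q $ (t * d)) (S $ (t * d))"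
proof -
  have e: "d + (q - 1) * d = q * d" using q by (cases q) auto
  have "(S * Q ^ (q - 1)) $ (t * (d + (q - 1) * d)) = S $ (t * d) * (Q $ (t * d)) ^ (q - 1)"
    using fps2_row_mult[OF S fps2_box_power[OF Q] t] fps2_row_power[OF Q t] by metis
  then show ?thesis
    unfolding e by (simp add: cartier2_def cartier_def mult.left_commute)
qed

lemma cartier2_column:
  fixes Q S :: "'b::comm_ring_1 fps fps"
  assumes q: "2 \<le> q" and Q: "Q \<in> fps2_box h d" and S: "S \<in> fps2_box h d" and t: "t = 0 \<or> t = 1"
  shows "fps2_column (t * h) (cartier2 q 0 Q S)
    = cartier q (fps2_column (t * h) Q) (fps2_column (t * h) S)"
proof -
  have e: "h + (q - 1) * h = q * h" using q by (cases q) auto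
  have "fps2_column (t * (h + (q - 1) * h)) (S * Q ^ (q - 1))
      = fps2_column (t * h) S * fps2_column (t * h) Q ^ (q - 1)"
    using fps2_column_mult[OF S fps2_box_power[OF Q] t] fps2_column_power[OF Q t] by metis
  then have *: "fps2_column (q * (t * h)) (S * Q ^ (q - 1))
      = fps2_column (t * h) S * fps2_column (t * h) Q ^ (q - 1)"
    unfolding e by (simp add: mult.left_commute)
  show ?thesis
    unfolding cartier_def *[symmetric] by (rule fps_ext) (simp add: cartier2_def)
qed

section \<open>Counting numerators\<close>

lemma funpow_periodic:
  fixes f :: "'x \<Rightarrow> 'x"
  assumes "(f ^^ (s + l)) x = (f ^^ s) x" "l dvd L" "s \<le> n"
  shows "(f ^^ (s + (n - s) mod L)) x = (f ^^ n) x"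
proof -
  have step: "(f ^^ (s + m + l)) x = (f ^^ (s + m)) x" for m
  proof -
    have "(f ^^ (s + m + l)) x = (f ^^ m) ((f ^^ (s + l)) x)"
      by (simp add: add.commute add.left_commute flip: funpow_add comp_apply[of "f ^^ _"])
    also have "\<dots> = (f ^^ (s + m)) x"
      unfolding assms(1) by (simp add: add.commute flip: funpow_add comp_apply[of "f ^^ _"])
    finally show ?thesis .
  qed
  have steps: "(f ^^ (s + m + l * c)) x = (f ^^ (s + m)) x" for m c
  proof (induction c)
    case (Suc c)
    have "(f ^^ (s + m + l * Suc c)) x = (f ^^ (s + (m + l * c) + l)) x" by (simp add: algebra_simps)
    also have "\<dots> = (f ^^ (s + m + l * c)) x" unfolding step by (simp add: algebra_simps)
    finally show ?case using Suc by simp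
  qed simp
  obtain c where c: "L = l * c" using assms(2) by auto
  have "n = s + (n - s) mod L + l * (c * ((n - s) div L))"
    using assms(3) mod_mult_div_eq[of "n - s" L] by (simp add: c mult.assoc)
  then show ?thesis using steps by metis
qed

text \<open>Asking for agreement outside \<open>J\<close>, and not for zeros there, covers both the
  smaller box and the families with prescribed edges.\<close>

lemma card_fps2_le:
  fixes A :: "'a::finite fps fps set"
  assumes "finite J" and agree: "\<And>F G n m. F \<in> A \<Longrightarrow> G \<in> A \<Longrightarrow> (n, m) \<notin> J \<Longrightarrow> F $ n $ m = G $ n $ m"
  shows "finite A" and "card A \<le> card (UNIV :: 'a set) ^ card J"
proof -
  let ?f = "\<lambda>F. restrict (\<lambda>(n, m). F $ n $ m) J"
  let ?B = "J \<rightarrow>\<^sub>E (UNIV :: 'a set)"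
  have inj: "inj_on ?f A"
  proof (rule inj_onI)
    fix F G assume FG: "F \<in> A" "G \<in> A" "?f F = ?f G"
    have "F $ n $ m = G $ n $ m" for n m
    proof (cases "(n, m) \<in> J")
      case True
      then show ?thesis using fun_cong[OF FG(3), of "(n, m)"] by simp
    qed (use agree FG in blast)
    then show "F = G" by (intro fps_ext)
  qed
  have sub: "?f ` A \<subseteq> ?B" by auto
  have fin: "finite ?B" using assms(1) by (simp add: finite_PiE)
  show "finite A" using inj sub fin by (metis finite_imageD finite_subset)
  have "card A = card (?f ` A)" using inj by (simp add: card_image)
  also have "\<dots> \<le> card ?B" using sub fin by (rule card_mono[rotated])
  also have "\<dots> = card (UNIV :: 'a set) ^ card J" using assms(1) by (simp add: card_funcsetE)
  finally show "card A \<le> card (UNIV :: 'a set) ^ card J" .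
qed

text \<open>The first \<open>s\<close> iterates are counted singly. From then on the four edges
  depend only on \<open>e - s\<close> modulo \<open>L\<close>, and the interior leaves
  \<open>(h - 1) * (d - 1)\<close> coefficients open.\<close>

lemma card_orbit_le:
  fixes Q P :: "'a::{field,finite} fps fps"
  assumes q: "q = card (UNIV :: 'a set)" and Q: "Q \<in> fps2_box h d" and P: "P \<in> fps2_box h d"
    and hd: "1 \<le> h" "1 \<le> d" and s: "max h d < q ^ s"
  defines "orb \<equiv> range (\<lambda>e. (cartier2 q 0 Q ^^ e) P)"
  shows "finite orb \<and> card orb \<le> s + landau4 h h d d * q ^ ((h - 1) * (d - 1))"
proof -
  have q2: "2 \<le> q" unfolding q by (rule two_le_card_field)
  let ?x = "\<lambda>e. (cartier2 q 0 Q ^^ e) P"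
  have box: "?x e \<in> fps2_box h d" for e
    by (induction e) (use P cartier2_fps2_box(1)[OF q2 Q] in auto)
  have row: "?x e $ (t * d) = (cartier q (Q $ (t * d)) ^^ e) (P $ (t * d))"
    if "t = 0 \<or> t = 1" for e t
    using cartier2_row[OF q2 Q box that] by (induction e) auto
  have col: "fps2_column (t * h) (?x e)
      = (cartier q (fps2_column (t * h) Q) ^^ e) (fps2_column (t * h) P)"
    if "t = 0 \<or> t = 1" for e t
    using cartier2_column[OF q2 Q box that] by (induction e) auto
  have row_per: "\<exists>\<sigma>\<in>partitions_upto h. (cartier q (Q $ n) ^^ (s + lcm_partition \<sigma>)) (P $ n)
      = (cartier q (Q $ n) ^^ s) (P $ n)" for n
    by (rule cartier_eventually_periodic[OF q]) (use hd s fps2_boxD[OF Q] fps2_boxD[OF P] in auto)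
  have col_per: "\<exists>\<sigma>\<in>partitions_upto d.
      (cartier q (fps2_column m Q) ^^ (s + lcm_partition \<sigma>)) (fps2_column m P)
      = (cartier q (fps2_column m Q) ^^ s) (fps2_column m P)" for m
    by (rule cartier_eventually_periodic[OF q]) (use hd s fps2_boxD[OF Q] fps2_boxD[OF P] in auto)
  \<comment> \<open>The products \<open>0 * d\<close> and \<open>1 * d\<close> keep the shape
    \<open>t * d\<close> of \<open>row\<close> and \<open>col\<close>.\<close>
  obtain \<sigma>1 \<sigma>2 \<sigma>3 \<sigma>4 where \<sigma>: "\<sigma>1 \<in> partitions_upto h" "\<sigma>2 \<in> partitions_upto h"
      "\<sigma>3 \<in> partitions_upto d" "\<sigma>4 \<in> partitions_upto d"
    and per: "(cartier q (Q $ (0 * d)) ^^ (s + lcm_partition \<sigma>1)) (P $ (0 * d))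
        = (cartier q (Q $ (0 * d)) ^^ s) (P $ (0 * d))"
      "(cartier q (Q $ (1 * d)) ^^ (s + lcm_partition \<sigma>2)) (P $ (1 * d))
        = (cartier q (Q $ (1 * d)) ^^ s) (P $ (1 * d))"
      "(cartier q (fps2_column (0 * h) Q) ^^ (s + lcm_partition \<sigma>3)) (fps2_column (0 * h) P)
        = (cartier q (fps2_column (0 * h) Q) ^^ s) (fps2_column (0 * h) P)"
      "(cartier q (fps2_column (1 * h) Q) ^^ (s + lcm_partition \<sigma>4)) (fps2_column (1 * h) P)
        = (cartier q (fps2_column (1 * h) Q) ^^ s) (fps2_column (1 * h) P)"
    using row_per col_per by metis
  define L where "L = lcm (lcm (lcm_partition \<sigma>1) (lcm_partition \<sigma>2))
    (lcm (lcm_partition \<sigma>3) (lcm_partition \<sigma>4))"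
  have dvd: "lcm_partition \<sigma>1 dvd L" "lcm_partition \<sigma>2 dvd L" "lcm_partition \<sigma>3 dvd L"
    "lcm_partition \<sigma>4 dvd L"
    unfolding L_def by (meson dvd_lcm1 dvd_lcm2 dvd_trans)+
  have "L \<in> landau_lcms h h d d" using \<sigma> unfolding landau_lcms_def L_def by blast
  then have L_le: "L \<le> landau4 h h d d"
    unfolding landau4_def using finite_landau_lcms by (intro Max_ge)
  have "lcm_partition \<sigma> \<noteq> 0" if "\<sigma> \<in> partitions_upto n" for \<sigma> n
    using lcm_partition_dvd_fact[OF that] by (metis dvd_0_left fact_nonzero)
  with \<sigma> have "L \<noteq> 0" unfolding L_def by (metis lcm_eq_0_iff)
  \<comment> \<open>The series in the box that share all four edges with iterate
    \<open>s + i\<close>.\<close>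
  define fib where "fib i = {F \<in> fps2_box h d. F $ 0 = ?x (s + i) $ 0 \<and> F $ d = ?x (s + i) $ d \<and>
    fps2_column 0 F = fps2_column 0 (?x (s + i)) \<and> fps2_column h F = fps2_column h (?x (s + i))}"
    for i
  have fib: "finite (fib i)" "card (fib i) \<le> q ^ ((h - 1) * (d - 1))" for i
  proof -
    let ?J = "{1..<d} \<times> {1..<h}"
    have agree: "F $ n $ m = G $ n $ m" if FG: "F \<in> fib i" "G \<in> fib i" and "(n, m) \<notin> ?J" for F G n m
    proof -
      consider "n = 0" | "n = d" | "d < n" | "m = 0" | "m = h" | "h < m"
        using \<open>(n, m) \<notin> ?J\<close> by force
      then show ?thesis
      proof cases
        case 4
        have "fps2_column 0 F = fps2_column 0 G" using FG by (simp add: fib_def)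
        then show ?thesis using 4 by (metis fps2_column_nth)
      next
        case 5
        have "fps2_column h F = fps2_column h G" using FG by (simp add: fib_def)
        then show ?thesis using 5 by (metis fps2_column_nth)
      qed (use FG in \<open>auto simp: fib_def fps2_boxD\<close>)
    qed
    have J: "finite ?J" "card ?J = (h - 1) * (d - 1)" by (simp_all add: mult.commute)
    show "finite (fib i)" "card (fib i) \<le> q ^ ((h - 1) * (d - 1))"
      using card_fps2_le[OF J(1) agree] unfolding J(2) q by auto
  qed
  have sub: "orb \<subseteq> ?x ` {..<s} \<union> (\<Union>i<L. fib i)"
  proof
    fix S assume "S \<in> orb"
    then obtain e where e: "S = ?x e" by (auto simp: orb_def)
    show "S \<in> ?x ` {..<s} \<union> (\<Union>i<L. fib i)"
    proof (cases "e < s")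
      case False
      then have "s \<le> e" by simp
      let ?i = "(e - s) mod L"
      have "?x e $ (0 * d) = ?x (s + ?i) $ (0 * d)" "?x e $ (1 * d) = ?x (s + ?i) $ (1 * d)"
        "fps2_column (0 * h) (?x e) = fps2_column (0 * h) (?x (s + ?i))"
        "fps2_column (1 * h) (?x e) = fps2_column (1 * h) (?x (s + ?i))"
        using funpow_periodic[OF per(1) dvd(1) \<open>s \<le> e\<close>] funpow_periodic[OF per(2) dvd(2) \<open>s \<le> e\<close>]
          funpow_periodic[OF per(3) dvd(3) \<open>s \<le> e\<close>] funpow_periodic[OF per(4) dvd(4) \<open>s \<le> e\<close>]
          row[of 0] row[of 1] col[of 0] col[of 1] by metis+
      then have "?x e \<in> fib ?i" using box by (simp add: fib_def)
      moreover have "?i < L" using \<open>L \<noteq> 0\<close> by simp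
      ultimately show ?thesis using e by blast
    qed (use e in auto)
  qed
  have fin: "finite (?x ` {..<s} \<union> (\<Union>i<L. fib i))" using fib by auto
  have "card orb \<le> card (?x ` {..<s} \<union> (\<Union>i<L. fib i))" using sub fin by (rule card_mono[rotated])
  also have "\<dots> \<le> card (?x ` {..<s}) + card (\<Union>i<L. fib i)" by (rule card_Un_le)
  also have "card (?x ` {..<s}) \<le> s" using card_image_le[of "{..<s}" ?x] by simp
  also have "card (\<Union>i<L. fib i) \<le> (\<Sum>i<L. card (fib i))" by (rule card_UN_le) simp
  also have "\<dots> \<le> (\<Sum>i<L. q ^ ((h - 1) * (d - 1)))" by (intro sum_mono fib)
  also have "\<dots> \<le> landau4 h h d d * q ^ ((h - 1) * (d - 1))" using L_le by simp
  finally show ?thesis using finite_subset[OF sub fin] by simp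
qed

text \<open>The smaller box has \<open>h * d\<close> coefficients and gives the leading term; the
  orbit of \<open>P\<close> gives the rest.\<close>

lemma card_q_kernel_le:
  fixes Q P I :: "'a::{field,finite} fps fps"
  assumes q: "q = card (UNIV :: 'a set)" and Q: "Q \<in> fps2_box h d" and P: "P \<in> fps2_box h d"
    and I: "Q * I = 1" and hd: "1 \<le> h" "1 \<le> d" and a: "\<And>n. a n = (P * I) $ n $ n"
    and s: "max h d < q ^ s"
  shows "finite (q_kernel q a)"
    and "card (q_kernel q a) \<le> q ^ (h * d) + (s + landau4 h h d d * q ^ ((h - 1) * (d - 1)))"
proof -
  let ?O = "range (\<lambda>e. (cartier2 q 0 Q ^^ e) P)" and ?V = "fps2_box (h - 1) (d - 1) :: 'a fps fps set"
  let ?J = "{..<d} \<times> {..<h}"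
  have agree: "F $ n $ m = G $ n $ m" if FG: "F \<in> ?V" "G \<in> ?V" and "(n, m) \<notin> ?J"
    for F G :: "'a fps fps" and n m
  proof -
    have "d - 1 < n \<or> h - 1 < m" using that(3) hd by auto
    then show ?thesis using fps2_boxD[OF FG(1)] fps2_boxD[OF FG(2)] by auto
  qed
  have J: "finite ?J" "card ?J = h * d" by (simp_all add: mult.commute)
  have V: "finite ?V" "card ?V \<le> q ^ (h * d)"
    using card_fps2_le[OF J(1) agree, of ?V] unfolding J(2) q by auto
  have O: "finite ?O" "card ?O \<le> s + landau4 h h d d * q ^ ((h - 1) * (d - 1))"
    using card_orbit_le[OF q Q P hd s] by auto
  let ?f = "\<lambda>S n. (S * I) $ n $ n"
  have sub: "q_kernel q a \<subseteq> ?f ` (?O \<union> ?V)"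
    by (rule q_kernel_subset_states[OF q Q P I hd a])
  have fin: "finite (?f ` (?O \<union> ?V))" using V O by blast
  show "finite (q_kernel q a)" using sub fin by (rule finite_subset)
  have "card (q_kernel q a) \<le> card (?f ` (?O \<union> ?V))" using sub fin by (rule card_mono[rotated])
  also have "\<dots> \<le> card (?O \<union> ?V)" using V O by (intro card_image_le) blast
  also have "\<dots> \<le> card ?O + card ?V" by (rule card_Un_le)
  finally show "card (q_kernel q a) \<le> q ^ (h * d) + (s + landau4 h h d d * q ^ ((h - 1) * (d - 1)))"
    using V O by linarith
qed

section \<open>Growth of the bound\<close>

text \<open>Distinct positive integers inserted in increasing order: each new maximum is at least
  the new cardinality.\<close>

lemma card_mult_Suc_card_le_sum:
  fixes A :: "nat set"
  assumes "finite A" "0 \<notin> A"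
  shows "card A * Suc (card A) \<le> 2 * \<Sum>A"
  using assms
proof (induction A rule: finite_linorder_max_induct)
  case (insert b A)
  then have "A \<subseteq> {1..<b}" by (auto intro!: Suc_leI gr0I)
  then have "card A \<le> b - 1" using card_mono[of "{1..<b}" A] by simp
  moreover have "0 < b" using insert.prems by auto
  ultimately have "Suc (card A) \<le> b" by simp
  moreover have "card A * Suc (card A) \<le> 2 * \<Sum>A" using insert by simp
  ultimately have "Suc (card A) * Suc (Suc (card A)) \<le> 2 * (b + \<Sum>A)" by (simp add: algebra_simps)
  then show ?case using insert by (subst card_insert_disjoint, auto)+
qed simp

text \<open>Only the distinct parts matter, and a set of positive integers with sum at most \<open>n\<close> has at most
  \<open>sqrt (2 n)\<close> elements.\<close>

lemma lcm_partition_le: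
  assumes "\<sigma> \<in> partitions_upto n"
  shows "real (lcm_partition \<sigma>) \<le> real n powr sqrt (2 * real n)"
proof -
  let ?A = "set_mset \<sigma>"
  obtain \<sigma>: "0 \<notin># \<sigma>" "sum_mset \<sigma> \<le> n" "1 \<le> n"
    using assms by (auto simp: partitions_upto_def is_partition_of_def)
  have "\<Sum>?A = sum_mset (mset_set ?A)" by (simp add: sum_unfold_sum_mset)
  also have "\<dots> \<le> sum_mset \<sigma>"
    using mset_set_set_mset_msubset[of \<sigma>] by (metis mset_subset_eq_exists_conv sum_mset.union le_add1)
  finally have sum: "\<Sum>?A \<le> n" using \<sigma>(2) by simp
  have "real (card ?A) \<le> sqrt (2 * real n)"
  proof (rule real_le_rsqrt)
    have "card ?A * card ?A \<le> card ?A * Suc (card ?A)" by simp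
    also have "\<dots> \<le> 2 * n" using card_mult_Suc_card_le_sum[of ?A] \<sigma>(1) sum by simp
    finally have "real (card ?A * card ?A) \<le> real (2 * n)" by (simp only: of_nat_le_iff)
    then show "(real (card ?A))\<^sup>2 \<le> 2 * real n" by (simp add: power2_eq_square)
  qed
  moreover have "x \<le> n" if "x \<in> ?A" for x
    using member_le_sum[OF that, of "\<lambda>x. x"] sum by simp
  then have "\<Prod>?A \<le> n ^ card ?A" using prod_mono[of ?A "\<lambda>x. x" "\<lambda>_. n"] by simp
  moreover have "lcm_partition \<sigma> dvd \<Prod>?A"
    unfolding lcm_partition_def by (rule Lcm_least) (auto intro: dvd_prodI[where f = "\<lambda>x. x", simplified])
  then have "lcm_partition \<sigma> \<le> \<Prod>?A"
    using \<sigma>(1) by (intro dvd_imp_le) (auto intro!: prod_pos gr0I)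
  ultimately have "lcm_partition \<sigma> \<le> n ^ card ?A"
    and le: "real n powr card ?A \<le> real n powr sqrt (2 * real n)"
    using \<sigma>(3) by (auto intro: powr_mono)
  then have "real (lcm_partition \<sigma>) \<le> real (n ^ card ?A)" by (simp only: of_nat_le_iff)
  also have "\<dots> = real n powr card ?A" using \<sigma>(3) by (simp add: powr_realpow)
  finally show ?thesis using le by linarith
qed

lemma landau4_le:
  assumes "1 \<le> h" "1 \<le> d"
  shows "real (landau4 h h d d)
    \<le> (real h powr sqrt (2 * real h))\<^sup>2 * (real d powr sqrt (2 * real d))\<^sup>2"
proof -
  have "landau4 h h d d \<in> landau_lcms h h d d"
    unfolding landau4_def using finite_landau_lcms landau_lcms_nonempty assms by (intro Max_in) auto
  then obtain \<sigma>1 \<sigma>2 \<sigma>3 \<sigma>4 where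
    eq: "landau4 h h d d = lcm (lcm (lcm_partition \<sigma>1) (lcm_partition \<sigma>2))
      (lcm (lcm_partition \<sigma>3) (lcm_partition \<sigma>4))"
    and \<sigma>: "\<sigma>1 \<in> partitions_upto h" "\<sigma>2 \<in> partitions_upto h"
             "\<sigma>3 \<in> partitions_upto d" "\<sigma>4 \<in> partitions_upto d"
    unfolding landau_lcms_def by blast
  have lcm_le: "lcm a b \<le> a * b" for a b :: nat
  proof (cases "a = 0 \<or> b = 0")
    case False
    have "lcm a b dvd a * b" by (rule lcm_least) simp_all
    then show ?thesis by (rule dvd_imp_le) (use False in simp)
  qed auto
  have "landau4 h h d d \<le> lcm_partition \<sigma>1 * lcm_partition \<sigma>2 * (lcm_partition \<sigma>3 * lcm_partition \<sigma>4)"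
    unfolding eq by (rule order_trans[OF lcm_le mult_mono[OF lcm_le lcm_le]]) auto
  then have "real (landau4 h h d d)
      \<le> real (lcm_partition \<sigma>1) * real (lcm_partition \<sigma>2) * (real (lcm_partition \<sigma>3) * real (lcm_partition \<sigma>4))"
    by (simp only: of_nat_le_iff flip: of_nat_mult)
  also have "\<dots> \<le> (real h powr sqrt (2 * real h)) * (real h powr sqrt (2 * real h))
      * ((real d powr sqrt (2 * real d)) * (real d powr sqrt (2 * real d)))"
    by (intro mult_mono \<sigma>[THEN lcm_partition_le]) auto
  finally show ?thesis by (simp add: power2_eq_square)
qed

text \<open>The exponent \<open>h + d - 1\<close> is \<open>h d - (h-1)(d-1)\<close>, and the
  logarithm is at most \<open>m\<close> because \<open>m < 2 ^ m\<close>. Nonnegativity is the lower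
  half of the squeeze in the limits.\<close>

lemma kernel_eps_bounds:
  assumes q: "2 \<le> q" and hd: "1 \<le> h" "1 \<le> d"
  defines "m \<equiv> max h d"
  shows "0 \<le> kernel_eps q h d"
    and "kernel_eps q h d \<le> landau4 h h d d / real q ^ (h + d - 1) + (2 * real m + 2) / real q ^ m"
proof -
  define fl where "fl = real_of_int \<lfloor>log (real q) (real m)\<rfloor>"
  have "0 \<le> log (real q) (real m)" using q hd by (simp add: m_def)
  then have fl0: "0 \<le> fl" by (simp add: fl_def)
  have "m < 2 ^ m" by (rule less_exp)
  also have "(2::nat) ^ m \<le> q ^ m" using q by (intro power_mono) auto
  finally have "real m \<le> real (q ^ m)" by (simp only: of_nat_le_iff)
  then have "real m \<le> real q powr real m" using q by (simp add: powr_realpow)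
  then have "log (real q) (real m) \<le> real m"
    using q hd by (subst log_le_iff) (auto simp: m_def)
  then have flm: "fl \<le> real m" unfolding fl_def by linarith
  have qpos: "0 < real q ^ k" for k using q by simp
  have exp: "h * d = (h - 1) * (d - 1) + (h + d - 1)"
    using hd by (cases h; cases d) auto
  have eq: "kernel_eps q h d
      = landau4 h h d d / real q ^ (h + d - 1) + (2 * fl + 2) / real q ^ (h * d)"
  proof -
    have "real q ^ ((h - 1) * (d - 1)) * landau4 h h d d / real q ^ (h * d)
        = landau4 h h d d / real q ^ (h + d - 1)"
      unfolding exp power_add using q by simp
    then show ?thesis
      unfolding kernel_eps_def kernel_bound_def fl_def m_def using qpos[of "h * d"]
      by (simp add: add_divide_distrib)
  qed
  show "0 \<le> kernel_eps q h d" unfolding eq using fl0 by simp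
  have "m \<le> h * d" using hd by (auto simp: m_def)
  then have "real q ^ m \<le> real q ^ (h * d)" using q by (intro power_increasing) auto
  then have "(2 * fl + 2) / real q ^ (h * d) \<le> (2 * real m + 2) / real q ^ m"
    using fl0 flm qpos by (intro frac_le) auto
  then show "kernel_eps q h d
      \<le> landau4 h h d d / real q ^ (h + d - 1) + (2 * real m + 2) / real q ^ m"
    unfolding eq by simp
qed

section \<open>The three limits\<close>

lemma kernel_eps_tendsto_q:
  assumes hd: "1 \<le> h" "1 \<le> d"
  shows "(\<lambda>q. kernel_eps q h d) \<longlonglongrightarrow> 0"
proof (rule tendsto_sandwich)
  let ?C = "landau4 h h d d + (2 * real (max h d) + 2)"
  show "\<forall>\<^sub>F q in sequentially. 0 \<le> kernel_eps q h d"
    using eventually_ge_at_top[of 2] by eventually_elim (rule kernel_eps_bounds(1)[OF _ hd])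
  show "\<forall>\<^sub>F q in sequentially. kernel_eps q h d \<le> ?C / real q"
    using eventually_ge_at_top[of 2]
  proof eventually_elim
    case (elim q)
    have "real q ^ 1 \<le> real q ^ k" if "1 \<le> k" for k
      using elim that by (intro power_increasing) auto
    then have le: "c / real q ^ k \<le> c / real q" if "1 \<le> k" "0 \<le> c" for k c
      using elim that by (intro divide_left_mono) auto
    have "kernel_eps q h d \<le> landau4 h h d d / real q ^ (h + d - 1)
        + (2 * real (max h d) + 2) / real q ^ max h d"
      by (rule kernel_eps_bounds(2)[OF elim hd])
    also have "\<dots> \<le> landau4 h h d d / real q + (2 * real (max h d) + 2) / real q"
      using hd by (intro add_mono le) auto
    finally show ?case by (simp add: add_divide_distrib)
  qed
  show "(\<lambda>q. ?C / real q) \<longlonglongrightarrow> 0" by (rule lim_const_over_n)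
qed simp

text \<open>Lowering the base from \<open>q\<close> to \<open>2\<close> separates the main term into
  a function of \<open>h\<close> times the same function of \<open>d\<close>; with one of them
  fixed, that factor is constant.\<close>

lemma kernel_eps_le:
  assumes q: "2 \<le> q" and hd: "1 \<le> h" "1 \<le> d"
  shows "kernel_eps q h d \<le> 2 * ((real h powr sqrt (2 * real h))\<^sup>2 / 2 ^ h)
      * ((real d powr sqrt (2 * real d))\<^sup>2 / 2 ^ d) + (2 * real (max h d) + 2) / 2 ^ max h d"
proof -
  have le: "c / real q ^ k \<le> c / 2 ^ k" if "0 \<le> c" for k c
    using q that by (intro divide_left_mono power_mono mult_pos_pos) auto
  have two: "2 ^ h * 2 ^ d = (2::real) * 2 ^ (h + d - 1)"
    using hd by (cases h) (auto simp: power_add)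
  have "kernel_eps q h d \<le> landau4 h h d d / real q ^ (h + d - 1)
        + (2 * real (max h d) + 2) / real q ^ max h d"
    by (rule kernel_eps_bounds(2)[OF q hd])
  also have "\<dots> \<le> landau4 h h d d / 2 ^ (h + d - 1) + (2 * real (max h d) + 2) / 2 ^ max h d"
    by (intro add_mono le) auto
  also have "landau4 h h d d / 2 ^ (h + d - 1) = 2 * (landau4 h h d d / (2 ^ h * 2 ^ d))"
    unfolding two by simp
  also have "landau4 h h d d / (2 ^ h * 2 ^ d) \<le>
      (real h powr sqrt (2 * real h))\<^sup>2 * (real d powr sqrt (2 * real d))\<^sup>2 / (2 ^ h * 2 ^ d)"
    by (intro divide_right_mono landau4_le hd) auto
  finally show ?thesis by simp
qed

text \<open>For \<open>n \<ge> 1\<close> the logarithm of the term is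
  \<open>2 sqrt(2 n) ln n - n ln 2\<close>, where the linear part wins.\<close>

lemma powr_sqrt_power2_over_two_power_tendsto:
  "(\<lambda>n. (real n powr sqrt (2 * real n))\<^sup>2 / 2 ^ n) \<longlonglongrightarrow> 0"
  by real_asymp

lemma kernel_eps_tendsto_h:
  assumes q: "2 \<le> q" and d: "1 \<le> d"
  shows "(\<lambda>h. kernel_eps q h d) \<longlonglongrightarrow> 0"
proof (rule tendsto_sandwich)
  let ?g = "\<lambda>n. (real n powr sqrt (2 * real n))\<^sup>2 / 2 ^ n"
  let ?b = "\<lambda>h. 2 * ?g h * ?g d + (2 * real h + 2) / 2 ^ h"
  show "\<forall>\<^sub>F h in sequentially. 0 \<le> kernel_eps q h d"
    using eventually_ge_at_top[of 1] by eventually_elim (rule kernel_eps_bounds(1)[OF q _ d])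
  show "\<forall>\<^sub>F h in sequentially. kernel_eps q h d \<le> ?b h"
    \<comment> \<open>From \<open>d\<close> on, \<open>max h d\<close> is \<open>h\<close>.\<close>
    using eventually_ge_at_top[of d]
  proof eventually_elim
    case (elim h)
    then show ?case using kernel_eps_le[OF q _ d, of h] d by (simp add: max_absorb1)
  qed
  have "(\<lambda>h. (2 * real h + 2) / 2 ^ h) \<longlonglongrightarrow> 0" by real_asymp
  then have "?b \<longlonglongrightarrow> 2 * 0 * ?g d + 0"
    by (intro tendsto_intros powr_sqrt_power2_over_two_power_tendsto)
  then show "?b \<longlonglongrightarrow> 0" by simp
qed simp

lemma kernel_eps_tendsto_d:
  assumes q: "2 \<le> q" and h: "1 \<le> h"
  shows "(\<lambda>d. kernel_eps q h d) \<longlonglongrightarrow> 0"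
proof (rule tendsto_sandwich)
  let ?g = "\<lambda>n. (real n powr sqrt (2 * real n))\<^sup>2 / 2 ^ n"
  let ?b = "\<lambda>d. 2 * ?g h * ?g d + (2 * real d + 2) / 2 ^ d"
  show "\<forall>\<^sub>F d in sequentially. 0 \<le> kernel_eps q h d"
    using eventually_ge_at_top[of 1] by eventually_elim (rule kernel_eps_bounds(1)[OF q h])
  show "\<forall>\<^sub>F d in sequentially. kernel_eps q h d \<le> ?b d"
    using eventually_ge_at_top[of h]
  proof eventually_elim
    case (elim d)
    then show ?case using kernel_eps_le[OF q h, of d] h by (simp add: max_absorb2)
  qed
  have "(\<lambda>d. (2 * real d + 2) / 2 ^ d) \<longlonglongrightarrow> 0" by real_asymp
  then have "?b \<longlonglongrightarrow> 2 * ?g h * 0 + 0"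
    by (intro tendsto_intros powr_sqrt_power2_over_two_power_tendsto)
  then show "?b \<longlonglongrightarrow> 0" by simp
qed simp

section \<open>The kernel of a diagonal\<close>

lemma degree_coeff_le_deg_x: "degree (coeff P n) \<le> deg_x P"
proof (cases "n \<le> degree P")
  case True
  then show ?thesis unfolding deg_x_def by (intro Max_ge) auto
qed (simp add: coeff_eq_0)

lemma fps2_of_poly2_box:
  assumes "deg_x P \<le> h" "deg_y P \<le> d"
  shows "fps2_of_poly2 P \<in> fps2_box h d"
  unfolding fps2_box_def
proof (intro CollectI allI impI)
  fix n m assume nz: "fps2_of_poly2 P $ n $ m \<noteq> 0"
  then have "coeff P n \<noteq> 0" by auto
  then have "n \<le> d" using le_degree[of P n] assms by simp
  moreover have "m \<le> degree (coeff P n)" using nz by (simp add: le_degree)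
  ultimately show "n \<le> d \<and> m \<le> h" using degree_coeff_le_deg_x[of P n] assms by simp
qed

lemma card_q_kernel_diagonal_le:
  fixes P Q :: "'a::{field,finite} poly poly"
  assumes q: "q = card (UNIV :: 'a set)" and Q0: "poly (poly Q 0) 0 \<noteq> 0"
    and F: "Abs_fps a = diagonal (fps2_quotient P Q)"
    and h: "h = max (deg_x P) (deg_x Q)" and d: "d = max (deg_y P) (deg_y Q)"
    and hd: "1 \<le> h" "1 \<le> d"
  shows "finite (q_kernel q a)" and "real (card (q_kernel q a)) \<le> kernel_bound q h d"
proof -
  have q2: "2 \<le> q" unfolding q by (rule two_le_card_field)
  let ?P = "fps2_of_poly2 P" and ?Q = "fps2_of_poly2 Q"
  \<comment> \<open>\<open>I\<close> is the expansion of \<open>1/Q\<close>; with it, quotients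
    become products.\<close>
  define I where "I = fps2_quotient 1 Q"
  have "I * ?Q = fps2_of_poly2 1"
    using fps2_quotient_unique[OF Q0, of I 1] by (simp add: I_def)
  also have "fps2_of_poly2 1 = (1 :: 'a fps fps)" by (simp add: fps2_of_poly2_def)
  finally have I: "?Q * I = 1" by (simp add: mult.commute)
  then have "?P * I * ?Q = ?P" by (simp add: mult.assoc mult.commute[of I])
  then have quot: "?P * I = fps2_quotient P Q" using fps2_quotient_unique[OF Q0] by blast
  have a: "a n = (?P * I) $ n $ n" for n
    using arg_cong[OF F, of "\<lambda>F. F $ n"] by (simp add: diagonal_def quot)
  define fl where "fl = \<lfloor>log (real q) (real (max h d))\<rfloor>"
  have "0 \<le> log (real q) (real (max h d))" using q2 hd by simp
  then have fl0: "0 \<le> fl" by (simp add: fl_def)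
  \<comment> \<open>The least exponent with \<open>max h d < q ^ s\<close>; the \<open>s\<close>
    single iterates are paid for by \<open>2 * fl + 2\<close>.\<close>
  define s where "s = Suc (nat fl)"
  have "log (real q) (real (max h d)) < real s"
    unfolding s_def fl_def using fl0 fl_def by linarith
  then have "real (max h d) < real q powr real s"
    using q2 hd by (subst (asm) log_less_iff) auto
  then have "real (max h d) < real (q ^ s)" using q2 by (simp add: powr_realpow)
  then have s: "max h d < q ^ s" by (simp only: of_nat_less_iff)
  have box: "?Q \<in> fps2_box h d" "?P \<in> fps2_box h d"
    by (rule fps2_of_poly2_box; simp add: h d)+
  show "finite (q_kernel q a)" by (rule card_q_kernel_le(1)[OF q box I hd a s])
  have "card (q_kernel q a) \<le> q ^ (h * d) + (s + landau4 h h d d * q ^ ((h - 1) * (d - 1)))"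
    by (rule card_q_kernel_le(2)[OF q box I hd a s])
  then have "real (card (q_kernel q a))
      \<le> real (q ^ (h * d) + (s + landau4 h h d d * q ^ ((h - 1) * (d - 1))))"
    by (simp only: of_nat_le_iff)
  also have "\<dots> \<le> kernel_bound q h d"
    using fl0 by (simp add: kernel_bound_def s_def fl_def[symmetric] mult.commute)
  finally show "real (card (q_kernel q a)) \<le> kernel_bound q h d" .
qed

theorem theorem35:
  fixes q :: nat
  assumes "q = card (UNIV :: 'a::{field,finite} set)"
  shows
    "(\<forall>(P :: 'a poly poly) (Q :: 'a poly poly) (F :: 'a fps) (a :: nat \<Rightarrow> 'a) (h :: nat) (d :: nat).
        poly (poly Q 0) 0 \<noteq> 0 \<and>
        F = diagonal (fps2_quotient P Q) \<and>
        F = Abs_fps a \<and>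
        h = max (deg_x P) (deg_x Q) \<and> d = max (deg_y P) (deg_y Q) \<and>
        h \<ge> 1 \<and> d \<ge> 1 \<longrightarrow>
          finite (q_kernel q a) \<and>
          real (card (q_kernel q a)) \<le> kernel_bound q h d \<and>
          real (card (q_kernel q a)) \<le> (1 + kernel_eps q h d) * real q ^ (h * d)) \<and>
     (\<forall>h\<ge>1. \<forall>d\<ge>1. (\<lambda>q'. kernel_eps q' h d) \<longlonglongrightarrow> 0) \<and>
     (\<forall>d\<ge>1. (\<lambda>h. kernel_eps q h d) \<longlonglongrightarrow> 0) \<and>
     (\<forall>h\<ge>1. (\<lambda>d. kernel_eps q h d) \<longlonglongrightarrow> 0)"
proof -
  have q2: "2 \<le> q" unfolding assms by (rule two_le_card_field)
  \<comment> \<open>By the choice of \<open>kernel_eps\<close> the asymptotic estimate is the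
    explicit bound itself.\<close>
  have eps: "(1 + kernel_eps q h d) * real q ^ (h * d) = kernel_bound q h d" for h d
    using q2 by (simp add: kernel_eps_def)
  show ?thesis
    unfolding eps
  proof (intro conjI allI impI; (elim conjE)?)
    fix P Q :: "'a poly poly" and F :: "'a fps" and a h d
    assume PQ: "poly (poly Q 0) 0 \<noteq> 0" "F = diagonal (fps2_quotient P Q)" "F = Abs_fps a"
      "h = max (deg_x P) (deg_x Q)" "d = max (deg_y P) (deg_y Q)" "1 \<le> h" "1 \<le> d"
    have F: "Abs_fps a = diagonal (fps2_quotient P Q)" using PQ(2,3) by simp
    note kernel = card_q_kernel_diagonal_le[OF assms PQ(1) F PQ(4-7)]
    show "finite (q_kernel q a)" "real (card (q_kernel q a)) \<le> kernel_bound q h d"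
      "real (card (q_kernel q a)) \<le> kernel_bound q h d"
      by (rule kernel)+
  qed (rule kernel_eps_tendsto_q kernel_eps_tendsto_h[OF q2] kernel_eps_tendsto_d[OF q2]; assumption)+
qed

end
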